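(* Let $n \in \{1,2,3,\dots\}$. The number of $2$-nilpotent Mal'cev algebras on the set $\{1,2,\ldots,n\}$, counted up to term equivalence, is finite if and only if $n$ is squarefree.
   Context: Operations of algebras are finitary of positive arity; signatures may be arbitrary. The term operations of an algebra are those obtained by composition from its basic operations and projections; the set of all of them is its (term) clone. Two algebras with the same underlying set are term equivalent if they have the same term clone. A Mal'cev algebra is an algebra with a ternary term operation $m$ satisfying $m(x,y,y)=x=m(y,y,x)$. $[\cdot,\cdot]$ is the (term condition) commutator of congruences; $\mathbf{A}$ is $2$-nilpotent if $[1_{\mathbf A},[1_{\mathbf A},1_{\mathbf A}]]=0_{\mathbf A}$, where $0_{\mathbf A},1_{\mathbf A}$ are the least and greatest congruences of $\mathbf A$ (in particular abelian algebras are $2$-nilpotent). *)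

theory Defs
  imports
    "HOL-Library.FuncSet"
    "HOL-Library.Infinite_Typeclass"
    "HOL-Computational_Algebra.Squarefree"
begin

text \<open>
  The signature is part of an algebra: a set of operation symbols of type \<open>'s\<close> together
  with their arities. The values of \<open>arity\<close> outside \<open>symbols\<close>, and those of \<open>interp\<close> outside
  \<open>symbols\<close> and on lists that are not tuples over the carrier of the right length, are irrelevant.
\<close>

record ('s, 'a) ualg =
  carrier :: "'a set"
  symbols :: "'s set"
  arity :: "'s \<Rightarrow> nat"
  interp :: "'s \<Rightarrow> 'a list \<Rightarrow> 'a"

definition tuples :: "'a set \<Rightarrow> nat \<Rightarrow> 'a list set" where
  "tuples X k = {xs. set xs \<subseteq> X \<and> length xs = k}"

definition is_ualg :: "('s, 'a) ualg \<Rightarrow> bool" where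
  "is_ualg A \<longleftrightarrow> carrier A \<noteq> {} \<and>
     (\<forall>s \<in> symbols A. 0 < arity A s \<and> interp A s \<in> tuples (carrier A) (arity A s) \<rightarrow> carrier A)"

text \<open>
  A \<open>k\<close>-ary operation is a pair \<open>(k, f)\<close>. The functions are made \<open>undefined\<close> outside
  the \<open>k\<close>-tuples over the carrier, so that equality of pairs is equality of operations.
\<close>

inductive_set clone :: "('s, 'a) ualg \<Rightarrow> (nat \<times> ('a list \<Rightarrow> 'a)) set"
  for A :: "('s, 'a) ualg" where
  proj: "i < k \<Longrightarrow> (k, restrict (\<lambda>xs. xs ! i) (tuples (carrier A) k)) \<in> clone A"
| basic: "s \<in> symbols A \<Longrightarrow>
    (arity A s, restrict (interp A s) (tuples (carrier A) (arity A s))) \<in> clone A"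
| comp: "(length gs, f) \<in> clone A \<Longrightarrow> 0 < k \<Longrightarrow> (\<And>g. g \<in> set gs \<Longrightarrow> (k, g) \<in> clone A) \<Longrightarrow>
    (k, restrict (\<lambda>xs. f (map (\<lambda>g. g xs) gs)) (tuples (carrier A) k)) \<in> clone A"

definition term_equivalent :: "('s, 'a) ualg \<Rightarrow> ('s, 'a) ualg \<Rightarrow> bool" where
  "term_equivalent A B \<longleftrightarrow> carrier A = carrier B \<and> clone A = clone B"

definition malcev :: "('s, 'a) ualg \<Rightarrow> bool" where
  "malcev A \<longleftrightarrow> (\<exists>m. (3, m) \<in> clone A \<and>
     (\<forall>x \<in> carrier A. \<forall>y \<in> carrier A. m [x, y, y] = x \<and> m [y, y, x] = x))"

definition congruence :: "('s, 'a) ualg \<Rightarrow> ('a \<times> 'a) set \<Rightarrow> bool" where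
  "congruence A r \<longleftrightarrow> equiv (carrier A) r \<and>
     (\<forall>s \<in> symbols A. \<forall>xs ys. length xs = arity A s \<and> list_all2 (\<lambda>x y. (x, y) \<in> r) xs ys \<longrightarrow>
        (interp A s xs, interp A s ys) \<in> r)"

definition zero_cong :: "('s, 'a) ualg \<Rightarrow> ('a \<times> 'a) set" where
  "zero_cong A = Id_on (carrier A)"

definition one_cong :: "('s, 'a) ualg \<Rightarrow> ('a \<times> 'a) set" where
  "one_cong A = carrier A \<times> carrier A"

text \<open>The term condition: \<open>\<alpha>\<close> centralizes \<open>\<beta>\<close> modulo \<open>\<delta>\<close>.\<close>

definition centralizes ::
  "('s, 'a) ualg \<Rightarrow> ('a \<times> 'a) set \<Rightarrow> ('a \<times> 'a) set \<Rightarrow> ('a \<times> 'a) set \<Rightarrow> bool" where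
  "centralizes A \<alpha> \<beta> \<delta> \<longleftrightarrow>
     (\<forall>t as bs cs ds. (length as + length cs, t) \<in> clone A \<longrightarrow>
        list_all2 (\<lambda>a b. (a, b) \<in> \<alpha>) as bs \<longrightarrow> list_all2 (\<lambda>c d. (c, d) \<in> \<beta>) cs ds \<longrightarrow>
        (t (as @ cs), t (as @ ds)) \<in> \<delta> \<longrightarrow> (t (bs @ cs), t (bs @ ds)) \<in> \<delta>)"

text \<open>
  The commutator is the least congruence satisfying the term condition. The family below contains
  \<open>one_cong A\<close> and is closed under intersections, so its intersection is its least element.
\<close>

definition commutator ::
  "('s, 'a) ualg \<Rightarrow> ('a \<times> 'a) set \<Rightarrow> ('a \<times> 'a) set \<Rightarrow> ('a \<times> 'a) set" where
  "commutator A \<alpha> \<beta> = \<Inter> {\<delta>. congruence A \<delta> \<and> centralizes A \<alpha> \<beta> \<delta>}"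

definition two_nilpotent :: "('s, 'a) ualg \<Rightarrow> bool" where
  "two_nilpotent A \<longleftrightarrow>
     commutator A (one_cong A) (commutator A (one_cong A) (one_cong A)) = zero_cong A"

definition two_nilpotent_malcev_algebras :: "'a set \<Rightarrow> ('s, 'a) ualg set" where
  "two_nilpotent_malcev_algebras X =
     {A. is_ualg A \<and> carrier A = X \<and> malcev A \<and> two_nilpotent A}"

definition term_equivalence_classes :: "('s, 'a) ualg set \<Rightarrow> ('s, 'a) ualg set set" where
  "term_equivalence_classes K = K // {(A, B). A \<in> K \<and> B \<in> K \<and> term_equivalent A B}"

end

theory Submission
  imports "HOL-Number_Theory.Cong" "HOL-Algebra.Multiplicative_Group" "HOL-Algebra.Sylow" Defs
begin

text \<open>
  \<^emph>\<open>Squarefree orders.\<close> Let \<open>\<theta> = [1, 1]\<close> in a 2-nilpotent Mal'cev algebra with Mal'cev operation \<open>M\<close>.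
  The term condition makes every term operation commute with \<open>M\<close>, modulo \<open>\<theta>\<close> on arbitrary arguments
  and exactly when the first two arguments of \<open>M\<close> are \<open>\<theta>\<close>-related
  (\<open>malcev_commutes_mod_commutator\<close>). Hence \<open>M\<close> is \<open>x - y + z\<close> for an abelian group on the set of blocks
  and for one on a single block, and translations from block to block show that all blocks have the same size.
  The order of the algebra is therefore a product \<open>q l\<close>; if it is squarefree, then both groups are cyclic
  and \<open>q\<close> and \<open>l\<close> are coprime, and every element has coordinates \<open>(\<chi>, \<kappa>)\<close> in \<open>\<int>/q \<times> \<int>/l\<close>
  (\<open>exists_coordinates\<close>).

  In these coordinates a term operation is affine in \<open>\<chi>\<close>, while its \<open>\<kappa>\<close>-part is linear in the \<open>\<kappa>\<close>'s of the
  arguments plus an arbitrary function of their \<open>\<chi>\<close>'s. Two operations that differ only in this last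
  function have a difference \<open>(\<int>/q)^k \<rightarrow> \<int>/l\<close>. The differences that occur form a family of abelian groups,
  closed under substituting affine combinations with coefficient sum 1 (a clonoid). A clone is thus known
  once one operation of each linear type and the differences are known. The linear types come from
  binary operations: \<open>f\<close> has the type of a signed sum of its minors
  \<open>f(x\<^sub>0, \<dots>, x\<^sub>i, \<dots>, x\<^sub>0)\<close>, formed by \<open>M\<close>. The heart
  of the proof is that a clonoid is determined by its binary members
  (\<open>clonoid_determined_by_binary\<close>): for a prime \<open>p\<close> dividing \<open>q\<close>, the function
  \<open>p F\<close> on the plane over \<open>\<int>/p\<close> is a combination of functions of one linear form each
  (\<open>line_decomposition\<close>), and \<open>p\<close> can be cancelled because it is invertible modulo \<open>l\<close>. So the variables
  can be merged, one prime and one variable at a time, until two are left. Consequently the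
  clone is generated by its ternary operations (\<open>clone_determined_by_ternary_operations\<close>), and on a
  finite set there are only finitely many sets of those.

  \<^emph>\<open>Orders with a square divisor.\<close> If \<open>n = x c\<close> with \<open>x \<ge> 2\<close> and \<open>x\<close> dividing \<open>c\<close>, then \<open>\<int>/n\<close> with the
  operations \<open>x - y + z\<close> and \<open>c w\<^sub>1 \<cdots> w\<^sub>d\<close> is 2-nilpotent, because modulo \<open>n\<close> the
  multiple \<open>c P\<close> of a polynomial depends only on residues modulo \<open>x\<close>, and these on residues modulo \<open>c\<close>.
  Its term operations are linear forms plus \<open>c\<close> times a polynomial of degree at most \<open>d\<close>. An alternating sum over the vertices of a cube of dimension \<open>j > d\<close> annihilates all of these but not
  \<open>c w\<^sub>1 \<cdots> w\<^sub>j\<close>, so different \<open>d\<close> give different clones.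
\<close>

section \<open>Abelian groups of squarefree order\<close>

lemma (in group) exists_elem_prime_order:
  assumes "finite (partial_object.carrier G)" and p: "prime p" "p dvd order G"
  shows "\<exists>x \<in> partial_object.carrier G. ord x = p"
proof -
  obtain m where m: "order G = p ^ 1 * m" using p by auto
  obtain H where H: "subgroup H G" "card H = p"
    using sylow_thm[OF p(1) group_axioms m assms(1)] by auto
  have "card H > 1" using H(2) prime_gt_1_nat[OF p(1)] by simp
  then have "H \<noteq> {\<one>}" by auto
  then obtain x where x: "x \<in> H" "x \<noteq> \<one>"
    using subgroup.one_closed[OF H(1)] by blast
  have xG: "x \<in> partial_object.carrier G" using x H by (meson subgroup.mem_carrier)
  interpret HG: group "G\<lparr>partial_object.carrier := H\<rparr>" using H(1) by (rule subgroup_imp_group)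
  have "x [^]\<^bsub>G\<lparr>partial_object.carrier := H\<rparr>\<^esub> p = \<one>"
    using HG.pow_order_eq_1[of x] x H by (simp add: order_def)
  then have "x [^] p = \<one>" using nat_pow_consistent[of x p H] by simp
  then have "ord x dvd p" using pow_eq_id xG by blast
  then have "ord x = p" using p(1) x xG ord_eq_1 by (metis prime_nat_iff)
  then show ?thesis using xG by blast
qed

text \<open>
  Multiplying commuting elements of coprime orders multiplies the orders, and a squarefree number is
  built up from distinct primes.
\<close>
lemma (in comm_group) squarefree_exists_elem_of_order:
  assumes "finite (partial_object.carrier G)" "squarefree (order G)" "d dvd order G"
  shows "\<exists>x \<in> partial_object.carrier G. ord x = d"
  using assms(3)
proof (induction d rule: prime_divisors_induct)
  case zero
  then show ?case using assms(2) by simp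
next
  case (unit d)
  then show ?case using ord_id by (metis nat_dvd_1_iff_1 one_closed)
next
  case (factor p d)
  obtain y where y: "y \<in> partial_object.carrier G" "ord y = d" using factor by (meson dvd_mult_right)
  obtain x where x: "x \<in> partial_object.carrier G" "ord x = p"
    using exists_elem_prime_order[OF assms(1) factor(1)] factor.prems by (meson dvd_mult_left)
  have "squarefree (p * d)" using factor.prems assms(2) squarefree_mono by blast
  then have "\<not> p dvd d" using factor(1)
    by (metis mult_dvd_mono dvd_refl not_prime_unit power2_eq_square squarefreeD)
  then have cop: "coprime p d" using factor(1) by (simp add: prime_imp_coprime)
  have "(x \<otimes> y) [^] n = \<one> \<longleftrightarrow> p * d dvd n" for n :: nat
  proof
    assume eq: "(x \<otimes> y) [^] n = \<one>"
    have "(x \<otimes> y) [^] (n * d) = \<one>" using eq x y by (simp flip: nat_pow_pow)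
    moreover have "y [^] (n * d) = \<one>" using y pow_eq_id by simp
    ultimately have "x [^] (n * d) = \<one>" using x y by (simp add: pow_mult_distrib m_comm)
    then have "p dvd n * d" using x pow_eq_id by blast
    then have pn: "p dvd n" using cop by (simp add: coprime_dvd_mult_left_iff)
    have "(x \<otimes> y) [^] (n * p) = \<one>" using eq x y by (simp flip: nat_pow_pow)
    moreover have "x [^] (n * p) = \<one>" using x pow_eq_id by simp
    ultimately have "y [^] (n * p) = \<one>" using x y by (simp add: pow_mult_distrib m_comm)
    then have "d dvd n * p" using y pow_eq_id by blast
    then have "d dvd n" using cop by (simp add: coprime_dvd_mult_left_iff coprime_commute)
    with pn show "p * d dvd n" using cop divides_mult by blast
  next
    assume "p * d dvd n"
    then have "p dvd n" "d dvd n" by (meson dvd_mult_left dvd_mult_right)+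
    then have "x [^] n = \<one>" "y [^] n = \<one>" using x y pow_eq_id by blast+
    then show "(x \<otimes> y) [^] n = \<one>" using x y by (simp add: pow_mult_distrib m_comm)
  qed
  then have "ord (x \<otimes> y) = p * d" using x y by (subst ord_unique) auto
  then show ?case using x y by blast
qed

text \<open>
  For \<open>d\<close> the full group order, the element found above is a generator; the coordinate is the exponent.
\<close>
lemma (in comm_group) squarefree_order_discrete_log:
  assumes fin: "finite (partial_object.carrier G)" and sf: "squarefree (order G)"
  obtains \<phi> :: "'a \<Rightarrow> int"
  where "bij_betw \<phi> (partial_object.carrier G) {0..<int (order G)}"
    and "\<And>x y. x \<in> partial_object.carrier G \<Longrightarrow> y \<in> partial_object.carrier G \<Longrightarrow>
      [\<phi> (x \<otimes> y) = \<phi> x + \<phi> y] (mod int (order G))"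
proof -
  obtain g where g: "g \<in> partial_object.carrier G" "ord g = order G"
    using squarefree_exists_elem_of_order[OF fin sf, of "order G"] by auto
  define N where "N = int (order G)"
  have N: "N > 0" using fin by (simp add: N_def order_gt_0_iff_finite)
  define e where "e i = g [^] i" for i :: int
  have inj: "inj_on e {0..<N}"
  proof (rule inj_onI)
    fix i j assume ij: "i \<in> {0..<N}" "j \<in> {0..<N}" "e i = e j"
    then have "N dvd j - i" using int_pow_eq[OF g(1), of i j] g by (simp add: e_def N_def)
    then have "j mod N = i mod N" by (simp add: mod_eq_dvd_iff)
    then show "i = j" using ij by simp
  qed
  have sub: "e ` {0..<N} \<subseteq> partial_object.carrier G" using g by (auto simp: e_def)
  have "card (e ` {0..<N}) = card (partial_object.carrier G)"
    using card_image[OF inj] by (simp add: N_def order_def)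
  then have img: "e ` {0..<N} = partial_object.carrier G" using card_subset_eq[OF fin sub] by simp
  define \<phi> where "\<phi> = inv_into {0..<N} e"
  have bij: "bij_betw \<phi> (partial_object.carrier G) {0..<N}"
    unfolding \<phi>_def by (rule bij_betw_inv_into) (simp add: bij_betw_def inj img)
  have e\<phi>: "e (\<phi> x) = x" if "x \<in> partial_object.carrier G" for x
    using that img by (simp add: \<phi>_def f_inv_into_f)
  have "[\<phi> (x \<otimes> y) = \<phi> x + \<phi> y] (mod N)" if xy: "x \<in> partial_object.carrier G" "y \<in> partial_object.carrier G" for x y
  proof -
    have "e (\<phi> x + \<phi> y) = e (\<phi> x) \<otimes> e (\<phi> y)" using g by (simp add: e_def int_pow_mult)
    also have "\<dots> = e (\<phi> (x \<otimes> y))" using xy by (simp add: e\<phi>)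
    finally have "N dvd \<phi> (x \<otimes> y) - (\<phi> x + \<phi> y)"
      using int_pow_eq[OF g(1), of "\<phi> x + \<phi> y"] g by (simp add: e_def N_def)
    then show ?thesis by (simp add: cong_iff_dvd_diff)
  qed
  with bij show thesis using that N_def by blast
qed

text \<open>
  A Mal'cev operation that commutes with itself is \<open>x - y + z\<close> in the abelian group \<open>x + y = M x u y\<close> whose
  zero \<open>u\<close> may be chosen freely. Each group law is the medial law for a \<open>3 \<times> 3\<close> matrix
  with \<open>u\<close> in the remaining places.
\<close>
lemma squarefree_affine_coordinate:
  fixes M :: "'a \<Rightarrow> 'a \<Rightarrow> 'a \<Rightarrow> 'a"
  assumes fin: "finite Y" and ne: "u \<in> Y" and sf: "squarefree (card Y)"
    and closed: "\<And>x y z. x \<in> Y \<Longrightarrow> y \<in> Y \<Longrightarrow> z \<in> Y \<Longrightarrow> M x y z \<in> Y"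
    and mal: "\<And>x y. x \<in> Y \<Longrightarrow> y \<in> Y \<Longrightarrow> M x y y = x" "\<And>x y. x \<in> Y \<Longrightarrow> y \<in> Y \<Longrightarrow> M y y x = x"
    and medial: "\<And>x1 x2 x3 y1 y2 y3 z1 z2 z3. {x1, x2, x3, y1, y2, y3, z1, z2, z3} \<subseteq> Y \<Longrightarrow>
      M (M x1 y1 z1) (M x2 y2 z2) (M x3 y3 z3) = M (M x1 x2 x3) (M y1 y2 y3) (M z1 z2 z3)"
  obtains \<phi> :: "'a \<Rightarrow> int"
  where "bij_betw \<phi> Y {0..<int (card Y)}"
    and "\<And>x y z. x \<in> Y \<Longrightarrow> y \<in> Y \<Longrightarrow> z \<in> Y \<Longrightarrow> [\<phi> (M x y z) = \<phi> x - \<phi> y + \<phi> z] (mod int (card Y))"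
proof -
  define G where "G = \<lparr>partial_object.carrier = Y, monoid.mult = (\<lambda>x y. M x u y), one = u\<rparr>"
  have minus: "M x u (M u y u) = M x y u" if "x \<in> Y" "y \<in> Y" for x y
    using medial[of x u u u u y u u u] that ne mal by simp
  have comm: "M x u y = M y u x" if "x \<in> Y" "y \<in> Y" for x y
    using medial[of u u y u u u x u u] that ne mal by simp
  have assoc: "M (M x u y) u z = M x u (M y u z)" if "x \<in> Y" "y \<in> Y" "z \<in> Y" for x y z
    using medial[of x u u u u u y u z] that ne mal by simp
  have heap: "M (M x u (M u y u)) u z = M x y z" if "x \<in> Y" "y \<in> Y" "z \<in> Y" for x y z
    using medial[of x u u y u u u u z] that ne mal minus by simp
  have inverse: "M (M u x u) u x = u" if "x \<in> Y" for x
    using heap[of u x x] that ne mal closed by (simp add: minus)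
  interpret G: comm_group G
  proof (rule comm_groupI)
    show "\<exists>y\<in>partial_object.carrier G. y \<otimes>\<^bsub>G\<^esub> x = \<one>\<^bsub>G\<^esub>" if "x \<in> partial_object.carrier G" for x
      using that inverse[of x] closed ne by (auto simp: G_def)
  qed (use closed ne assoc comm mal in \<open>auto simp: G_def\<close>)
  have "order G = card Y" by (simp add: order_def G_def)
  obtain \<phi> :: "'a \<Rightarrow> int" where bij: "bij_betw \<phi> Y {0..<int (card Y)}"
    and hom: "\<And>x y. x \<in> Y \<Longrightarrow> y \<in> Y \<Longrightarrow> [\<phi> (M x u y) = \<phi> x + \<phi> y] (mod int (card Y))"
    using G.squarefree_order_discrete_log fin sf
    unfolding \<open>order G = card Y\<close> by (auto simp: G_def)
  have "[\<phi> (M x y z) = \<phi> x - \<phi> y + \<phi> z] (mod int (card Y))" if "x \<in> Y" "y \<in> Y" "z \<in> Y" for x y z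
  proof -
    let ?c = "\<lambda>a b. [a = b] (mod int (card Y))"
    have cl: "M u y u \<in> Y" "M x u (M u y u) \<in> Y" using that closed ne by auto
    have h0: "?c (\<phi> u) (\<phi> u + \<phi> u)" using hom[of u u] ne mal by simp
    have h1: "?c (\<phi> u) (\<phi> (M u y u) + \<phi> y)" using hom[OF cl(1) that(2)] that inverse by simp
    have h2: "?c (\<phi> (M x u (M u y u))) (\<phi> x + \<phi> (M u y u))" using hom that cl by simp
    have h3: "?c (\<phi> (M x y z)) (\<phi> (M x u (M u y u)) + \<phi> z)" using hom[OF cl(2) that(3)] heap that by simp
    obtain a0 a1 a2 a3 where "\<phi> u + \<phi> u = \<phi> u + int (card Y) * a0"
      "\<phi> (M u y u) + \<phi> y = \<phi> u + int (card Y) * a1"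
      "\<phi> x + \<phi> (M u y u) = \<phi> (M x u (M u y u)) + int (card Y) * a2"
      "\<phi> (M x u (M u y u)) + \<phi> z = \<phi> (M x y z) + int (card Y) * a3"
      using h0 h1 h2 h3 by (metis cong_iff_lin)
    then have "\<phi> x - \<phi> y + \<phi> z = \<phi> (M x y z) + int (card Y) * (a3 + a2 - a1 - a0)"
      by (simp add: algebra_simps)
    then show ?thesis by (metis cong_iff_lin)
  qed
  with bij show thesis using that by blast
qed

section \<open>Term operations and the term condition\<close>

lemma map_upt_in_tuples [intro]: "(\<And>i. i < k \<Longrightarrow> x i \<in> X) \<Longrightarrow> map x [0..<k] \<in> tuples X k"
  by (auto simp: tuples_def)

lemma tuples_nth: "xs \<in> tuples X k \<Longrightarrow> i < k \<Longrightarrow> xs ! i \<in> X"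
  by (auto simp: tuples_def)

lemma tuples_map_nth: "xs \<in> tuples X k \<Longrightarrow> map (\<lambda>i. xs ! i) [0..<k] = xs"
  by (auto simp: tuples_def intro: nth_equalityI)

lemma clone_arity_pos: "is_ualg A \<Longrightarrow> (k, f) \<in> clone A \<Longrightarrow> 0 < k"
  by (erule clone.cases) (auto simp: is_ualg_def)

lemma clone_extensional: "(k, f) \<in> clone A \<Longrightarrow> f \<in> extensional (tuples (carrier A) k)"
  by (erule clone.cases) auto

lemma clone_closed:
  assumes "is_ualg A" "(k, f) \<in> clone A" "xs \<in> tuples (carrier A) k"
  shows "f xs \<in> carrier A"
  using assms(2,3)
proof (induction arbitrary: xs)
  case (proj i k)
  then show ?case by (simp add: tuples_nth)
next
  case (basic s)
  then show ?case using assms(1) by (auto simp: is_ualg_def Pi_def)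
next
  case (comp gs f k)
  then have "map (\<lambda>g. g xs) gs \<in> tuples (carrier A) (length gs)"
    by (auto simp: tuples_def)
  then show ?case using comp by simp
qed

text \<open>
  Members of a clone are undefined outside the tuples over the carrier. Working with the functions
  whose restriction lies in the clone allows plain composition.
\<close>
definition term_op :: "('s, 'a) ualg \<Rightarrow> nat \<Rightarrow> ('a list \<Rightarrow> 'a) \<Rightarrow> bool" where
  "term_op A k F \<longleftrightarrow> (k, restrict F (tuples (carrier A) k)) \<in> clone A"

lemma clone_iff_term_op: "(k, f) \<in> clone A \<longleftrightarrow> term_op A k f \<and> f \<in> extensional (tuples (carrier A) k)"
  by (metis clone_extensional extensional_restrict term_op_def)

lemma term_op_cong:
  "term_op A k F \<Longrightarrow> (\<And>xs. xs \<in> tuples (carrier A) k \<Longrightarrow> F xs = F' xs) \<Longrightarrow> term_op A k F'"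
  unfolding term_op_def by (metis restrict_ext)

lemma term_op_proj: "i < k \<Longrightarrow> term_op A k (\<lambda>xs. xs ! i)"
  unfolding term_op_def by (rule clone.proj)

lemma term_op_arity_pos: "is_ualg A \<Longrightarrow> term_op A k F \<Longrightarrow> 0 < k"
  unfolding term_op_def by (rule clone_arity_pos)

lemma term_op_closed: "is_ualg A \<Longrightarrow> term_op A k F \<Longrightarrow> xs \<in> tuples (carrier A) k \<Longrightarrow> F xs \<in> carrier A"
  unfolding term_op_def by (drule (2) clone_closed) simp

lemma term_op_comp:
  assumes A: "is_ualg A" and f: "term_op A j f" and k: "0 < k" and G: "\<And>i. i < j \<Longrightarrow> term_op A k (G i)"
  shows "term_op A k (\<lambda>xs. f (map (\<lambda>i. G i xs) [0..<j]))"
proof -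
  let ?X = "carrier A"
  let ?gs = "map (\<lambda>i. restrict (G i) (tuples ?X k)) [0..<j]"
  have "(k, restrict (\<lambda>xs. restrict f (tuples ?X j) (map (\<lambda>g. g xs) ?gs)) (tuples ?X k)) \<in> clone A"
    by (rule clone.comp[where f = "restrict f (tuples ?X j)"])
      (use f k G in \<open>auto simp del: restrict_apply simp: term_op_def\<close>)
  moreover have "restrict (\<lambda>xs. restrict f (tuples ?X j) (map (\<lambda>g. g xs) ?gs)) (tuples ?X k)
      = restrict (\<lambda>xs. f (map (\<lambda>i. G i xs) [0..<j])) (tuples ?X k)"
  proof (rule restrict_ext)
    fix xs assume xs: "xs \<in> tuples ?X k"
    then have "map (\<lambda>i. G i xs) [0..<j] \<in> tuples ?X j"
      using term_op_closed[OF A G] by auto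
    moreover have "map (\<lambda>g. g xs) ?gs = map (\<lambda>i. G i xs) [0..<j]" using xs by simp
    ultimately show "restrict f (tuples ?X j) (map (\<lambda>g. g xs) ?gs) = f (map (\<lambda>i. G i xs) [0..<j])"
      by (simp only: restrict_apply if_True)
  qed
  ultimately show ?thesis by (simp add: term_op_def)
qed

lemma list_all2_in_tuples:
  assumes "r \<subseteq> X \<times> X" "length xs = k" "list_all2 (\<lambda>x y. (x, y) \<in> r) xs ys"
  shows "xs \<in> tuples X k" "ys \<in> tuples X k"
  using assms unfolding tuples_def list_all2_conv_all_nth
  by (fastforce simp: in_set_conv_nth)+

lemma congruence_clone:
  assumes A: "is_ualg A" and r: "congruence A r" and f: "(k, f) \<in> clone A"
    and xs: "length xs = k" "list_all2 (\<lambda>x y. (x, y) \<in> r) xs ys"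
  shows "(f xs, f ys) \<in> r"
  using f xs
proof (induction arbitrary: xs ys)
  case (proj i k)
  have sub: "r \<subseteq> carrier A \<times> carrier A"
    using r by (auto simp: congruence_def equiv_def refl_on_def)
  then have "xs \<in> tuples (carrier A) k" "ys \<in> tuples (carrier A) k"
    using list_all2_in_tuples[OF sub] proj.prems by blast+
  then show ?case using proj by (auto simp: list_all2_conv_all_nth)
next
  case (basic s)
  have sub: "r \<subseteq> carrier A \<times> carrier A"
    using r by (auto simp: congruence_def equiv_def refl_on_def)
  then have "xs \<in> tuples (carrier A) (arity A s)" "ys \<in> tuples (carrier A) (arity A s)"
    using list_all2_in_tuples[OF sub] basic.prems by blast+
  then show ?case using basic r by (auto simp: congruence_def)
next
  case (comp gs f k)
  have sub: "r \<subseteq> carrier A \<times> carrier A"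
    using r by (auto simp: congruence_def equiv_def refl_on_def)
  then have "xs \<in> tuples (carrier A) k" "ys \<in> tuples (carrier A) k"
    using list_all2_in_tuples[OF sub] comp.prems by blast+
  moreover have "(f (map (\<lambda>g. g xs) gs), f (map (\<lambda>g. g ys) gs)) \<in> r"
    by (rule comp.IH) (use comp in \<open>auto simp: list_all2_conv_all_nth\<close>)
  ultimately show ?case by simp
qed

text \<open>
  Call the two sides \<open>P(x,y,z)\<close> and \<open>R(x,y,z)\<close>. Both equal \<open>f z\<close> if \<open>x = y\<close>, and both equal \<open>f x\<close> if \<open>y = z\<close>.
  So the term \<open>M P R v\<close> takes the value \<open>v\<close> in three corners of the square in which the third argument moves
  from \<open>y\<close> to \<open>z\<close> and the first one moves, within \<open>\<beta>\<close>, from \<open>y\<close> to \<open>x\<close>. The term condition forces it to be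
  congruent to \<open>v\<close> in the fourth corner; for \<open>v = R\<close> the term is \<open>P\<close> there.
\<close>
lemma malcev_commutes_mod_commutator:
  fixes A :: "('s, 'a) ualg" and M :: "'a \<Rightarrow> 'a \<Rightarrow> 'a \<Rightarrow> 'a"
  assumes A: "is_ualg A"
    and M: "term_op A 3 (\<lambda>xs. M (xs ! 0) (xs ! 1) (xs ! 2))"
    and mal: "\<And>x y. x \<in> carrier A \<Longrightarrow> y \<in> carrier A \<Longrightarrow> M x y y = x"
      "\<And>x y. x \<in> carrier A \<Longrightarrow> y \<in> carrier A \<Longrightarrow> M y y x = x"
    and \<beta>: "congruence A \<beta>" and \<delta>: "congruence A \<delta>"
    and cen: "centralizes A (one_cong A) \<beta> \<delta>"
    and f: "term_op A k f"
    and xyz: "\<And>i. i < k \<Longrightarrow> (x i, y i) \<in> \<beta>" "\<And>i. i < k \<Longrightarrow> z i \<in> carrier A"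
  shows "(f (map (\<lambda>i. M (x i) (y i) (z i)) [0..<k]),
          M (f (map x [0..<k])) (f (map y [0..<k])) (f (map z [0..<k]))) \<in> \<delta>"
proof -
  let ?X = "carrier A"
  have eqv: "equiv ?X \<beta>" "equiv ?X \<delta>" using \<beta> \<delta> by (auto simp: congruence_def)
  have xX: "x i \<in> ?X" and yX: "y i \<in> ?X" if "i < k" for i
    using xyz(1)[OF that] eqv by (auto simp: equiv_def refl_on_def)
  note X = xX yX xyz(2)
  have Mop: "term_op A j (\<lambda>w. M (F1 w) (F2 w) (F3 w))" if "term_op A j F1" "term_op A j F2" "term_op A j F3" for j F1 F2 F3
  proof -
    have "term_op A j (\<lambda>w. (\<lambda>xs. M (xs ! 0) (xs ! 1) (xs ! 2)) (map (\<lambda>i. ([F1, F2, F3] ! i) w) [0..<3]))"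
      by (rule term_op_comp[OF A M])
        (use that term_op_arity_pos[OF A that(1)] in \<open>auto simp: less_Suc_eq numeral_3_eq_3\<close>)
    then show ?thesis by (rule term_op_cong) simp
  qed
  have fX: "f (map t [0..<k]) \<in> ?X" if "\<And>i. i < k \<Longrightarrow> t i \<in> ?X" for t
    using that by (intro term_op_closed[OF A f] map_upt_in_tuples)
  have MX: "M a b c \<in> ?X" if "a \<in> ?X" "b \<in> ?X" "c \<in> ?X" for a b c
    using term_op_closed[OF A M, of "[a, b, c]"] that by (simp add: tuples_def)
  let ?fx = "f (map x [0..<k])" and ?fy = "f (map y [0..<k])" and ?fz = "f (map z [0..<k])"
  define P where "P w = f (map (\<lambda>i. M (w ! (2 * k + 1 + i)) (w ! (k + i)) (w ! i)) [0..<k])" for w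
  define R where "R w = M (f (map (\<lambda>i. w ! (2 * k + 1 + i)) [0..<k])) (f (map (\<lambda>i. w ! (k + i)) [0..<k]))
    (f (map (\<lambda>i. w ! i) [0..<k]))" for w
  define W where "W w = M (P w) (R w) (w ! (2 * k))" for w
  let ?N = "(2 * k + 1) + k"
  have W: "term_op A ?N W"
    unfolding W_def P_def R_def
    by (intro Mop term_op_comp[OF A f] term_op_proj) auto
  define v where "v = M ?fx ?fy ?fz"
  have vX: "v \<in> ?X" unfolding v_def using X by (intro MX fX) auto
  define L where "L s1 s2 s3 = map s1 [0..<k] @ map s2 [0..<k] @ [v] @ map s3 [0..<k]" for s1 s2 s3 :: "nat \<Rightarrow> 'a"
  have nths: "L s1 s2 s3 ! i = s1 i" "L s1 s2 s3 ! (k + i) = s2 i" "L s1 s2 s3 ! (2 * k + 1 + i) = s3 i"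
    "L s1 s2 s3 ! (2 * k) = v" if "i < k" for s1 s2 s3 i
    using that by (auto simp: L_def nth_append)
  have k0: "0 < k" using term_op_arity_pos[OF A f] .
  have WL: "W (L s1 s2 s3) = M (f (map (\<lambda>i. M (s3 i) (s2 i) (s1 i)) [0..<k]))
      (M (f (map s3 [0..<k])) (f (map s2 [0..<k])) (f (map s1 [0..<k]))) v" for s1 s2 s3
  proof -
    have "P (L s1 s2 s3) = f (map (\<lambda>i. M (s3 i) (s2 i) (s1 i)) [0..<k])"
      unfolding P_def by (intro arg_cong[where f = f] map_cong refl) (simp only: nths set_upt atLeastLessThan_iff)
    moreover have "R (L s1 s2 s3) = M (f (map s3 [0..<k])) (f (map s2 [0..<k])) (f (map s1 [0..<k]))"
      unfolding R_def by (intro arg_cong3[where f = M] arg_cong[where f = f] map_cong refl) (simp_all only: nths set_upt atLeastLessThan_iff)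
    ultimately show ?thesis unfolding W_def using nths(4)[OF k0] by simp
  qed
  have LX: "L s1 s2 s3 \<in> tuples ?X ?N" if "\<And>i. i < k \<Longrightarrow> s1 i \<in> ?X" "\<And>i. i < k \<Longrightarrow> s2 i \<in> ?X" "\<And>i. i < k \<Longrightarrow> s3 i \<in> ?X" for s1 s2 s3
    using that vX by (auto simp: L_def tuples_def)
  define t where "t = restrict W (tuples ?X ?N)"
  have t: "t (L s1 s2 s3) = W (L s1 s2 s3)" if "\<And>i. i < k \<Longrightarrow> s1 i \<in> ?X" "\<And>i. i < k \<Longrightarrow> s2 i \<in> ?X" "\<And>i. i < k \<Longrightarrow> s3 i \<in> ?X" for s1 s2 s3
    unfolding t_def using LX[OF that] by simp
  \<comment> \<open>The side that moves along the full congruence first, then the side that moves within \<open>\<beta>\<close>.\<close>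
  define as where "as = map y [0..<k] @ map y [0..<k] @ [v]"
  define bs where "bs = map z [0..<k] @ map y [0..<k] @ [v]"
  define cs where "cs = map y [0..<k]"
  define ds where "ds = map x [0..<k]"
  have L4: "as @ cs = L y y y" "as @ ds = L y y x" "bs @ cs = L z y y" "bs @ ds = L z y x"
    by (simp_all add: L_def as_def bs_def cs_def ds_def)
  have cols: "map (\<lambda>i. M (x i) (y i) (y i)) [0..<k] = map x [0..<k]"
    "map (\<lambda>i. M (y i) (y i) (y i)) [0..<k] = map y [0..<k]"
    "map (\<lambda>i. M (y i) (y i) (z i)) [0..<k] = map z [0..<k]"
    using X mal by (auto intro!: map_cong)
  have eq1: "t (as @ cs) = v" "t (as @ ds) = v" "t (bs @ cs) = v"
    unfolding L4 using X vX by (simp_all add: t WL mal fX cols)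
  have eq2: "t (bs @ ds) = f (map (\<lambda>i. M (x i) (y i) (z i)) [0..<k])"
  proof -
    have "f (map (\<lambda>i. M (x i) (y i) (z i)) [0..<k]) \<in> ?X" using X by (intro fX MX) auto
    then show ?thesis unfolding L4 using X vX by (simp add: t WL mal flip: v_def)
  qed
  have "length as + length cs = ?N" by (simp add: as_def cs_def)
  then have "(length as + length cs, t) \<in> clone A"
    using W by (simp only: term_op_def t_def)
  moreover have "list_all2 (\<lambda>a b. (a, b) \<in> one_cong A) as bs"
    using X vX by (auto simp: as_def bs_def one_cong_def list_all2_append list_all2_map1 list_all2_map2 list.rel_refl_strong list_all2_same)
  moreover have "list_all2 (\<lambda>c d. (c, d) \<in> \<beta>) cs ds"
  proof -
    have "(y i, x i) \<in> \<beta>" if "i < k" for i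
      using xyz(1)[OF that] eqv(1) by (meson equiv_def symD)
    then show ?thesis by (simp add: cs_def ds_def list_all2_map1 list_all2_map2 list_all2_same)
  qed
  moreover have "(t (as @ cs), t (as @ ds)) \<in> \<delta>"
    using eqv vX by (simp add: eq1 equiv_def refl_on_def)
  ultimately have "(t (bs @ cs), t (bs @ ds)) \<in> \<delta>"
    using cen unfolding centralizes_def by blast
  then have "(f (map (\<lambda>i. M (x i) (y i) (z i)) [0..<k]), v) \<in> \<delta>"
    unfolding eq1 eq2 using eqv(2) by (meson equiv_def symD)
  then show ?thesis by (simp add: v_def)
qed

section \<open>Coordinates on a central extension\<close>

text \<open>
  With \<open>\<theta> = [1, 1]\<close>, these are the consequences of \<open>C(1, 1; \<theta>)\<close> and \<open>C(1, \<theta>; 0)\<close> on which the rest of the proof is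
  built.
\<close>
locale central_extension =
  fixes A :: "('s, 'a) ualg" and M :: "'a \<Rightarrow> 'a \<Rightarrow> 'a \<Rightarrow> 'a" and \<theta> :: "('a \<times> 'a) set"
  assumes ualg: "is_ualg A"
    and M_op: "term_op A 3 (\<lambda>xs. M (xs ! 0) (xs ! 1) (xs ! 2))"
    and malcev_right: "\<And>x y. x \<in> carrier A \<Longrightarrow> y \<in> carrier A \<Longrightarrow> M x y y = x"
    and malcev_left: "\<And>x y. x \<in> carrier A \<Longrightarrow> y \<in> carrier A \<Longrightarrow> M y y x = x"
    and cong: "congruence A \<theta>"
    and affine: "\<And>k f x y z. term_op A k f \<Longrightarrow> (\<And>i. i < k \<Longrightarrow> x i \<in> carrier A) \<Longrightarrow> (\<And>i. i < k \<Longrightarrow> y i \<in> carrier A) \<Longrightarrow>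
      (\<And>i. i < k \<Longrightarrow> z i \<in> carrier A) \<Longrightarrow>
      (f (map (\<lambda>i. M (x i) (y i) (z i)) [0..<k]),
       M (f (map x [0..<k])) (f (map y [0..<k])) (f (map z [0..<k]))) \<in> \<theta>"
    and central: "\<And>k f x y z. term_op A k f \<Longrightarrow> (\<And>i. i < k \<Longrightarrow> (x i, y i) \<in> \<theta>) \<Longrightarrow>
      (\<And>i. i < k \<Longrightarrow> z i \<in> carrier A) \<Longrightarrow>
      f (map (\<lambda>i. M (x i) (y i) (z i)) [0..<k]) =
       M (f (map x [0..<k])) (f (map y [0..<k])) (f (map z [0..<k]))"
begin

lemma equiv_\<theta>: "equiv (carrier A) \<theta>"
  using cong by (simp add: congruence_def)

lemma \<theta>_carrier: "(x, y) \<in> \<theta> \<Longrightarrow> x \<in> carrier A \<and> y \<in> carrier A"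
  using equiv_\<theta> by (auto simp: equiv_def refl_on_def)

lemma \<theta>_refl: "x \<in> carrier A \<Longrightarrow> (x, x) \<in> \<theta>"
  using equiv_\<theta> by (auto simp: equiv_def refl_on_def)

lemma \<theta>_sym: "(x, y) \<in> \<theta> \<Longrightarrow> (y, x) \<in> \<theta>"
  using equiv_\<theta> by (auto simp: equiv_def dest: symD)

lemma \<theta>_trans: "(x, y) \<in> \<theta> \<Longrightarrow> (y, z) \<in> \<theta> \<Longrightarrow> (x, z) \<in> \<theta>"
  using equiv_\<theta> by (auto simp: equiv_def dest: transD)

lemma M_closed: "x \<in> carrier A \<Longrightarrow> y \<in> carrier A \<Longrightarrow> z \<in> carrier A \<Longrightarrow> M x y z \<in> carrier A"
  using term_op_closed[OF ualg M_op, of "[x, y, z]"] by (simp add: tuples_def)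

lemma M_cong:
  assumes "(x, x') \<in> \<theta>" "(y, y') \<in> \<theta>" "(z, z') \<in> \<theta>"
  shows "(M x y z, M x' y' z') \<in> \<theta>"
  using congruence_clone[OF ualg cong M_op[unfolded term_op_def], of "[x, y, z]" "[x', y', z']"]
    assms[THEN \<theta>_carrier] assms by (simp add: tuples_def)

lemma upt3: "[0..<3] = [0, 1, 2 :: nat]"
  by (simp add: upt_rec)

lemma all_less_3: "(\<forall>i<3. P i) \<longleftrightarrow> P 0 \<and> P 1 \<and> P (2 :: nat)"
  by (auto simp: less_Suc_eq numeral_3_eq_3 numeral_2_eq_2)

lemma medial_mod:
  assumes "{x1, x2, x3, y1, y2, y3, z1, z2, z3} \<subseteq> carrier A"
  shows "(M (M x1 y1 z1) (M x2 y2 z2) (M x3 y3 z3), M (M x1 x2 x3) (M y1 y2 y3) (M z1 z2 z3)) \<in> \<theta>"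
proof -
  have *: "[a, b, c] ! i \<in> carrier A" if "i < 3" "a \<in> carrier A" "b \<in> carrier A" "c \<in> carrier A" for a b c i
    using all_less_3[of "\<lambda>i. [a, b, c] ! i \<in> carrier A"] that by auto
  show ?thesis
    using affine[OF M_op, of "\<lambda>i. [x1, x2, x3] ! i" "\<lambda>i. [y1, y2, y3] ! i" "\<lambda>i. [z1, z2, z3] ! i"] assms *
    by (simp add: upt3)
qed

lemma medial:
  assumes "(x1, y1) \<in> \<theta>" "(x2, y2) \<in> \<theta>" "(x3, y3) \<in> \<theta>" and z: "z1 \<in> carrier A" "z2 \<in> carrier A" "z3 \<in> carrier A"
  shows "M (M x1 y1 z1) (M x2 y2 z2) (M x3 y3 z3) = M (M x1 x2 x3) (M y1 y2 y3) (M z1 z2 z3)"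
proof -
  have *: "[z1, z2, z3] ! i \<in> carrier A" if "i < 3" for i
    using all_less_3[of "\<lambda>i. [z1, z2, z3] ! i \<in> carrier A"] that z by auto
  have **: "([x1, x2, x3] ! i, [y1, y2, y3] ! i) \<in> \<theta>" if "i < 3" for i
    using all_less_3[of "\<lambda>i. ([x1, x2, x3] ! i, [y1, y2, y3] ! i) \<in> \<theta>"] that assms by auto
  show ?thesis
    using central[OF M_op, of "\<lambda>i. [x1, x2, x3] ! i" "\<lambda>i. [y1, y2, y3] ! i" "\<lambda>i. [z1, z2, z3] ! i", OF ** *]
    by (simp add: upt3)
qed

text \<open>
  Translating by \<open>b - a\<close> is a bijection from the block of \<open>a\<close> to the block of \<open>b\<close>, with the translation by \<open>a - b\<close>
  as inverse.
\<close>
lemma shift_back: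
  assumes "(x, a) \<in> \<theta>" "b \<in> carrier A"
  shows "M (M x a b) b a = x"
proof -
  have X: "x \<in> carrier A" "a \<in> carrier A" using assms \<theta>_carrier by auto
  have "M (M x a b) (M a a b) (M a a a) = M (M x a a) (M a a a) (M b b a)"
    by (rule medial) (use assms X \<theta>_refl in auto)
  then show ?thesis using X assms by (simp add: malcev_left malcev_right)
qed

text \<open>
  The coordinate \<open>\<chi>\<close> identifies the group of blocks with \<open>\<int>/q\<close>. For \<open>\<kappa>\<close>, a representative \<open>r x\<close> is fixed in every
  block; then \<open>x\<close> is translated to the block of \<open>u\<close> by \<open>u - r x\<close>, and that block is identified with \<open>\<int>/l\<close>. Since the
  choice of representatives is arbitrary, \<open>\<kappa>\<close> respects \<open>M\<close> only when the first two arguments lie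
  in the same block.
\<close>
theorem exists_coordinates:
  assumes fin: "finite (carrier A)" and sf: "squarefree (card (carrier A))"
  obtains q l :: nat and \<chi> \<kappa> :: "'a \<Rightarrow> int"
  where "q * l = card (carrier A)"
    and "\<And>x. x \<in> carrier A \<Longrightarrow> \<chi> x \<in> {0..<int q}" "\<And>x. x \<in> carrier A \<Longrightarrow> \<kappa> x \<in> {0..<int l}"
    and "\<And>a b. a \<in> {0..<int q} \<Longrightarrow> b \<in> {0..<int l} \<Longrightarrow> \<exists>x\<in>carrier A. \<chi> x = a \<and> \<kappa> x = b"
    and "\<And>x y. x \<in> carrier A \<Longrightarrow> y \<in> carrier A \<Longrightarrow> \<chi> x = \<chi> y \<Longrightarrow> \<kappa> x = \<kappa> y \<Longrightarrow> x = y"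
    and "\<And>x y. x \<in> carrier A \<Longrightarrow> y \<in> carrier A \<Longrightarrow> (x, y) \<in> \<theta> \<longleftrightarrow> \<chi> x = \<chi> y"
    and "\<And>x y z. x \<in> carrier A \<Longrightarrow> y \<in> carrier A \<Longrightarrow> z \<in> carrier A \<Longrightarrow>
      [\<chi> (M x y z) = \<chi> x - \<chi> y + \<chi> z] (mod int q)"
    and "\<And>x y z. x \<in> carrier A \<Longrightarrow> y \<in> carrier A \<Longrightarrow> z \<in> carrier A \<Longrightarrow> \<chi> x = \<chi> y \<Longrightarrow>
      [\<kappa> (M x y z) = \<kappa> x - \<kappa> y + \<kappa> z] (mod int l)"
proof -
  let ?X = "carrier A"
  obtain u where u: "u \<in> ?X" using ualg by (auto simp: is_ualg_def)
  define r where "r x = (SOME y. (x, y) \<in> \<theta>)" for x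
  have r_cong: "(x, r x) \<in> \<theta>" if "x \<in> ?X" for x
    unfolding r_def using \<theta>_refl[OF that] by (rule someI)
  have rX: "r x \<in> ?X" if "x \<in> ?X" for x using r_cong[OF that] \<theta>_carrier by blast
  have req: "r x = r y" if "(x, y) \<in> \<theta>" for x y
  proof -
    have "(\<lambda>z. (x, z) \<in> \<theta>) = (\<lambda>z. (y, z) \<in> \<theta>)" using that \<theta>_sym \<theta>_trans by blast
    then show ?thesis by (simp add: r_def)
  qed
  have r_iff: "(x, y) \<in> \<theta> \<longleftrightarrow> r x = r y" if "x \<in> ?X" "y \<in> ?X" for x y
    using that req r_cong \<theta>_sym \<theta>_trans by metis
  have rr: "r (r x) = r x" if "x \<in> ?X" for x using req[OF r_cong[OF that]] by simp
  define B where "B = {x \<in> ?X. (x, u) \<in> \<theta>}"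
  define \<kappa>' where "\<kappa>' x = M x (r x) u" for x
  have BX: "B \<subseteq> ?X" by (auto simp: B_def)
  have kappaB: "\<kappa>' x \<in> B" if "x \<in> ?X" for x
  proof -
    have "(\<kappa>' x, M (r x) (r x) u) \<in> \<theta>"
      unfolding \<kappa>'_def using that u by (intro M_cong r_cong \<theta>_refl rX)
    then show ?thesis using that u rX by (auto simp: B_def malcev_left dest: \<theta>_carrier)
  qed
  have recover: "M (\<kappa>' x) u (r x) = x" if "x \<in> ?X" for x
    unfolding \<kappa>'_def by (rule shift_back[OF r_cong[OF that] u])
  have comb: "r (M d u c) = c" "\<kappa>' (M d u c) = d" "M d u c \<in> ?X" if "c \<in> r ` ?X" "d \<in> B" for c d
  proof -
    have c: "c \<in> ?X" "r c = c" using that rX rr by auto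
    have d: "d \<in> ?X" "(d, u) \<in> \<theta>" using that by (auto simp: B_def)
    show "M d u c \<in> ?X" using c d u by (intro M_closed)
    have "(M d u c, M u u c) \<in> \<theta>" using c d u by (intro M_cong \<theta>_refl)
    then show rc: "r (M d u c) = c" using req c u by (metis malcev_left)
    show "\<kappa>' (M d u c) = d" unfolding \<kappa>'_def rc by (rule shift_back[OF d(2) c(1)])
  qed
  have bij: "bij_betw (\<lambda>x. (r x, \<kappa>' x)) ?X (r ` ?X \<times> B)"
    by (rule bij_betw_byWitness[where f' = "\<lambda>(c, d). M d u c"]) (use recover comb kappaB in auto)
  then have card: "card (r ` ?X) * card B = card ?X"
    using bij_betw_same_card by (fastforce simp: card_cartesian_product)
  have finB: "finite B" using fin BX finite_subset by blast
  have sfs: "squarefree (card (r ` ?X))" "squarefree (card B)"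
    using sf unfolding card[symmetric] by (rule squarefree_multD)+
  have rM: "r (M (r x) (r y) (r z)) = r (M x y z)" if "x \<in> ?X" "y \<in> ?X" "z \<in> ?X" for x y z
    using that by (intro req[OF \<theta>_sym[OF M_cong]] r_cong)
  obtain \<phi> :: "'a \<Rightarrow> int" where \<phi>: "bij_betw \<phi> (r ` ?X) {0..<int (card (r ` ?X))}"
    and phiM: "\<And>x y z. x \<in> r ` ?X \<Longrightarrow> y \<in> r ` ?X \<Longrightarrow> z \<in> r ` ?X \<Longrightarrow>
      [\<phi> (r (M x y z)) = \<phi> x - \<phi> y + \<phi> z] (mod int (card (r ` ?X)))"
  proof (rule squarefree_affine_coordinate[of "r ` ?X" "r u" "\<lambda>x y z. r (M x y z)"])
    fix x1 x2 x3 y1 y2 y3 z1 z2 z3 assume "{x1, x2, x3, y1, y2, y3, z1, z2, z3} \<subseteq> r ` ?X"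
    then have sub: "{x1, x2, x3, y1, y2, y3, z1, z2, z3} \<subseteq> ?X" using rX by blast
    then show "r (M (r (M x1 y1 z1)) (r (M x2 y2 z2)) (r (M x3 y3 z3))) =
      r (M (r (M x1 x2 x3)) (r (M y1 y2 y3)) (r (M z1 z2 z3)))"
      using req[OF medial_mod[OF sub]] by (simp add: rM M_closed)
  qed (use fin u sfs rX rr M_closed in \<open>auto simp: malcev_left malcev_right\<close>)
  obtain \<psi> :: "'a \<Rightarrow> int" where \<psi>: "bij_betw \<psi> B {0..<int (card B)}"
    and psiM: "\<And>x y z. x \<in> B \<Longrightarrow> y \<in> B \<Longrightarrow> z \<in> B \<Longrightarrow>
      [\<psi> (M x y z) = \<psi> x - \<psi> y + \<psi> z] (mod int (card B))"
  proof (rule squarefree_affine_coordinate[of B u M])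
    fix x y z assume "x \<in> B" "y \<in> B" "z \<in> B"
    then have "(M x y z, M u u u) \<in> \<theta>" by (intro M_cong) (auto simp: B_def)
    then show "M x y z \<in> B" using u by (auto simp: B_def malcev_left dest: \<theta>_carrier)
  next
    fix x1 x2 x3 y1 y2 y3 z1 z2 z3 assume sub: "{x1, x2, x3, y1, y2, y3, z1, z2, z3} \<subseteq> B"
    have "(a, b) \<in> \<theta>" if "a \<in> B" "b \<in> B" for a b using that \<theta>_trans[of a u b] \<theta>_sym[of b u] by (simp add: B_def)
    then show "M (M x1 y1 z1) (M x2 y2 z2) (M x3 y3 z3) = M (M x1 x2 x3) (M y1 y2 y3) (M z1 z2 z3)"
      using sub BX by (intro medial) auto
  qed (use finB sfs u \<theta>_refl BX in \<open>auto simp: malcev_left malcev_right B_def\<close>)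
  have kappaM: "\<kappa>' (M x y z) = M (\<kappa>' x) (\<kappa>' y) (\<kappa>' z)" if xy: "(x, y) \<in> \<theta>" and z: "z \<in> ?X" for x y z
  proof -
    have x: "x \<in> ?X" and y: "y \<in> ?X" using xy \<theta>_carrier by auto
    define a where "a = r y"
    define w where "w = \<kappa>' z"
    have a: "a \<in> ?X" "(y, a) \<in> \<theta>" "(x, a) \<in> \<theta>" "r x = a"
      using xy y rX r_cong req \<theta>_trans by (auto simp: a_def)
    have w: "w \<in> ?X" using kappaB[OF z] BX by (auto simp: w_def)
    have "(M x y z, M y y z) \<in> \<theta>" using xy y z by (intro M_cong \<theta>_refl)
    then have rz: "r (M x y z) = r z" using req y z by (simp add: malcev_left)
    have "M (M x y z) (M y y (r z)) (M y y u) = M (M x y y) (M y y y) (M z (r z) u)"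
      by (rule medial) (use x y z u xy rX \<theta>_refl in auto)
    then have 1: "\<kappa>' (M x y z) = M x y w"
      using x y z u rX by (simp add: \<kappa>'_def w_def rz malcev_left malcev_right)
    have "M (M x a u) (M y a u) (M a a w) = M (M x y a) (M a a a) (M u u w)"
      by (rule medial) (use x y a u w \<theta>_refl in auto)
    then have 2: "M (\<kappa>' x) (\<kappa>' y) w = M (M x y a) a w"
      using a u w by (simp add: \<kappa>'_def malcev_left malcev_right flip: a_def)
    have "M (M x y a) (M y y a) (M y y w) = M (M x y y) (M y y y) (M a a w)"
      by (rule medial) (use x y a u w xy \<theta>_refl in auto)
    then have 3: "M (M x y a) a w = M x y w"
      using a x y w by (simp add: malcev_left malcev_right)
    show ?thesis using 1 2 3 by (simp add: w_def)
  qed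
  have inj_phi: "\<phi> a = \<phi> b \<longleftrightarrow> a = b" if "a \<in> r ` ?X" "b \<in> r ` ?X" for a b
    using \<phi> that by (meson bij_betw_def inj_on_eq_iff)
  have inj_psi: "\<psi> a = \<psi> b \<longleftrightarrow> a = b" if "a \<in> B" "b \<in> B" for a b
    using \<psi> that by (meson bij_betw_def inj_on_eq_iff)
  show thesis
  proof (rule that[of "card (r ` ?X)" "card B" "\<lambda>x. \<phi> (r x)" "\<lambda>x. \<psi> (\<kappa>' x)"])
    show "card (r ` ?X) * card B = card ?X" by fact
    show "\<phi> (r x) \<in> {0..<int (card (r ` ?X))}" if "x \<in> ?X" for x
      using \<phi> that by (meson bij_betw_apply imageI)
    show "\<psi> (\<kappa>' x) \<in> {0..<int (card B)}" if "x \<in> ?X" for x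
      using \<psi> kappaB[OF that] by (rule bij_betw_apply)
    show "\<exists>x\<in>?X. \<phi> (r x) = a \<and> \<psi> (\<kappa>' x) = b" if "a \<in> {0..<int (card (r ` ?X))}" "b \<in> {0..<int (card B)}" for a b
    proof -
      have "a \<in> \<phi> ` r ` ?X" "b \<in> \<psi> ` B"
        using that bij_betw_imp_surj_on[OF \<phi>] bij_betw_imp_surj_on[OF \<psi>] by auto
      then obtain c d where cd: "c \<in> r ` ?X" "\<phi> c = a" "d \<in> B" "\<psi> d = b" by blast
      then show ?thesis using comb[OF cd(1,3)] by (intro bexI[of _ "M d u c"]) auto
    qed
    show "x = y" if "x \<in> ?X" "y \<in> ?X" "\<phi> (r x) = \<phi> (r y)" "\<psi> (\<kappa>' x) = \<psi> (\<kappa>' y)" for x y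
    proof -
      have "r x = r y" by (rule inj_phi[THEN iffD1, OF _ _ that(3)]) (use that in auto)
      moreover have "\<kappa>' x = \<kappa>' y" by (rule inj_psi[THEN iffD1, OF kappaB kappaB that(4)]) (use that in auto)
      ultimately show ?thesis by (subst recover[OF that(1), symmetric], subst recover[OF that(2), symmetric]) (simp only:)
    qed
    show "(x, y) \<in> \<theta> \<longleftrightarrow> \<phi> (r x) = \<phi> (r y)" if "x \<in> ?X" "y \<in> ?X" for x y
      unfolding r_iff[OF that] by (rule inj_phi[symmetric]) (use that in auto)
    show "[\<phi> (r (M x y z)) = \<phi> (r x) - \<phi> (r y) + \<phi> (r z)] (mod int (card (r ` ?X)))"
      if "x \<in> ?X" "y \<in> ?X" "z \<in> ?X" for x y z
      using phiM[of "r x" "r y" "r z"] that by (simp add: rM)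
    show "[\<psi> (\<kappa>' (M x y z)) = \<psi> (\<kappa>' x) - \<psi> (\<kappa>' y) + \<psi> (\<kappa>' z)] (mod int (card B))"
      if "x \<in> ?X" "y \<in> ?X" "z \<in> ?X" "\<phi> (r x) = \<phi> (r y)" for x y z
    proof -
      have "r x = r y" by (rule inj_phi[THEN iffD1, OF _ _ that(4)]) (use that in auto)
      then have xy: "(x, y) \<in> \<theta>" using r_iff[OF that(1,2)] by simp
      show ?thesis unfolding kappaM[OF xy that(3)] by (intro psiM kappaB that(1-3))
    qed
  qed
qed

end

section \<open>Clonoids from a cyclic group of squarefree order\<close>

lemma sum_periodic_dilate:
  fixes f :: "int \<Rightarrow> int" and p s :: int
  assumes "prime p" and "\<not> p dvd s" and per: "\<And>u. f (u mod p) = f u"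
  shows "(\<Sum>t\<in>{0..<p}. f (s * t + c)) = (\<Sum>t\<in>{0..<p}. f t)"
proof -
  have p: "p > 0" using assms(1) by (simp add: prime_gt_0_int)
  have inj: "inj_on (\<lambda>t. (s * t + c) mod p) {0..<p}"
  proof (rule inj_onI)
    fix x y assume xy: "x \<in> {0..<p}" "y \<in> {0..<p}" "(s * x + c) mod p = (s * y + c) mod p"
    then have "p dvd s * (x - y)" by (simp add: mod_eq_dvd_iff algebra_simps)
    then have "p dvd x - y" using assms by (simp add: prime_dvd_mult_iff)
    then have "x mod p = y mod p" by (simp add: mod_eq_dvd_iff)
    then show "x = y" using xy by simp
  qed
  have "(\<lambda>t. (s * t + c) mod p) ` {0..<p} = {0..<p}"
    by (rule endo_inj_surj) (use inj p in auto)
  then have "(\<Sum>t\<in>{0..<p}. f t) = (\<Sum>t\<in>{0..<p}. f ((s * t + c) mod p))"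
    using sum.reindex[OF inj, of f] by simp
  then show ?thesis by (simp add: per)
qed

text \<open>
  For fixed \<open>b\<close> the map \<open>t \<mapsto> t (x + b y)\<close> turns the inner double sum into the sum of \<open>F\<close> along the line
  \<open>{(u, t). u + b t = x + b y}\<close> minus the sum along its parallel through the origin; if \<open>x + b y = 0\<close>, both
  differences are zero. The lines of the first kind all pass through \<open>(x, y)\<close>: together they cover that point \<open>p\<close> times and
  every point outside the row of \<open>y\<close> once; the lines of the second kind do the same for the origin. The
  last sum supplies the difference of the two rows that are missed.
\<close>
lemma line_decomposition:
  fixes F :: "int \<Rightarrow> int \<Rightarrow> int" and p x y :: int
  assumes p: "prime p" and per1: "\<And>u v. F (u mod p) v = F u v" and per2: "\<And>u v. F u (v mod p) = F u v"
  shows "p * F x y = p * F 0 0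
    + (\<Sum>b\<in>{0..<p}. \<Sum>t\<in>{0..<p}. F ((1 - b * t) * (x + b * y)) (t * (x + b * y)) - F (- b * t * (x + b * y)) (t * (x + b * y)))
    + (\<Sum>t\<in>{0..<p}. F (t * y) y - F (t * y) 0)"
proof -
  have p0: "p > 0" using p by (simp add: prime_gt_0_int)
  have cong1: "F u v = F u' v" if "p dvd u - u'" for u u' v
    using that per1 by (metis mod_eq_dvd_iff)
  have cong2: "F u v = F u v'" if "p dvd v - v'" for u v v'
    using that per2 by (metis mod_eq_dvd_iff)
  define R where "R v = (\<Sum>u\<in>{0..<p}. F u v)" for v
  have A: "(\<Sum>t\<in>{0..<p}. F ((1 - b * t) * s) (t * s) - F (- b * t * s) (t * s))
      = (\<Sum>t\<in>{0..<p}. F (s - b * t) t - F (- b * t) t)" for b s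
  proof (cases "p dvd s")
    case True
    have "F ((1 - b * t) * s) (t * s) = F (- b * t * s) (t * s)" for t
      by (rule cong1) (use True in \<open>simp add: algebra_simps\<close>)
    moreover have "F (s - b * t) t = F (- b * t) t" for t
      by (rule cong1) (use True in \<open>simp add: algebra_simps\<close>)
    ultimately show ?thesis by simp
  next
    case False
    define g where "g u = F (s - b * u) u - F (- b * u) u" for u
    have "g (u mod p) = g u" for u
    proof -
      have "F (s - b * (u mod p)) (u mod p) = F (s - b * u) u"
      proof -
        have "F (s - b * (u mod p)) (u mod p) = F (s - b * (u mod p)) u" by (rule per2)
        also have "\<dots> = F (s - b * u) u"
          by (rule cong1) (simp add: mod_eq_dvd_iff[symmetric] mod_diff_right_eq mod_simps)
        finally show ?thesis .
      qed
      moreover have "F (- b * (u mod p)) (u mod p) = F (- b * u) u"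
      proof -
        have "F (- b * (u mod p)) (u mod p) = F (- b * (u mod p)) u" by (rule per2)
        also have "\<dots> = F (- b * u) u"
          by (rule cong1) (simp add: mod_eq_dvd_iff[symmetric] mod_simps)
        finally show ?thesis .
      qed
      ultimately show ?thesis by (simp add: g_def)
    qed
    with sum_periodic_dilate[of p s g 0] p False
    show ?thesis by (simp add: g_def algebra_simps)
  qed
  have row: "(\<Sum>b\<in>{0..<p}. F (x + b * y - b * t) t) = (if p dvd y - t then p * F x y else R t)" for t
  proof (cases "p dvd y - t")
    case True
    have "F (x + b * y - b * t) t = F x y" for b
    proof -
      have "F (x + b * y - b * t) t = F x t"
        by (rule cong1) (use True in \<open>simp flip: right_diff_distrib\<close>)
      also have "\<dots> = F x y" by (rule cong2) (use True in \<open>simp add: dvd_diff_commute\<close>)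
      finally show ?thesis .
    qed
    then show ?thesis using True p0 by simp
  next
    case False
    from sum_periodic_dilate[of p "y - t" "\<lambda>u. F u t" x] p show ?thesis
      using False by (simp add: per1 R_def algebra_simps)
  qed
  have row0: "(\<Sum>b\<in>{0..<p}. F (- b * t) t) = (if t = 0 then p * F 0 0 else R t)" if "t \<in> {0..<p}" for t
  proof (cases "t = 0")
    case True then show ?thesis using p0 by simp
  next
    case False
    then have "\<not> p dvd - t" using that by (auto dest: zdvd_imp_le)
    from sum_periodic_dilate[of p "- t" "\<lambda>u. F u t" 0] p this show ?thesis
      using False by (simp add: per1 R_def algebra_simps)
  qed
  have Rmod: "R (y mod p) = R y" by (simp add: R_def per2)
  have only: "p dvd y - t \<longleftrightarrow> t = y mod p" if "t \<in> {0..<p}" for t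
    using that by (auto simp: mod_eq_dvd_iff[symmetric])
  have S1: "(\<Sum>t\<in>{0..<p}. \<Sum>b\<in>{0..<p}. F (x + b * y - b * t) t) = (\<Sum>t\<in>{0..<p}. R t) + p * F x y - R y"
  proof -
    have "(\<Sum>t\<in>{0..<p}. \<Sum>b\<in>{0..<p}. F (x + b * y - b * t) t)
       = (\<Sum>t\<in>{0..<p}. R t + (if t = y mod p then p * F x y - R (y mod p) else 0))"
      by (rule sum.cong) (auto simp: row only)
    also have "\<dots> = (\<Sum>t\<in>{0..<p}. R t) + (p * F x y - R y)"
      using p0 by (simp add: sum.distrib Rmod)
    finally show ?thesis by simp
  qed
  have S2: "(\<Sum>t\<in>{0..<p}. \<Sum>b\<in>{0..<p}. F (- b * t) t) = (\<Sum>t\<in>{0..<p}. R t) + p * F 0 0 - R 0"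
  proof -
    have "(\<Sum>t\<in>{0..<p}. \<Sum>b\<in>{0..<p}. F (- b * t) t)
       = (\<Sum>t\<in>{0..<p}. R t + (if t = 0 then p * F 0 0 - R 0 else 0))"
      by (rule sum.cong) (auto simp: row0 simp del: mult_minus_left minus_mult_left)
    also have "\<dots> = (\<Sum>t\<in>{0..<p}. R t) + (p * F 0 0 - R 0)"
      using p0 by (simp add: sum.distrib)
    finally show ?thesis by simp
  qed
  have S3: "(\<Sum>t\<in>{0..<p}. F (t * y) y - F (t * y) 0) = R y - R 0"
  proof (cases "p dvd y")
    case True
    have "F (t * y) y = F (t * y) 0" for t by (rule cong2) (use True in simp)
    moreover have "R y = R 0" unfolding R_def by (rule sum.cong[OF refl], rule cong2) (use True in simp)
    ultimately show ?thesis by simp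
  next
    case False
    from sum_periodic_dilate[of p y "\<lambda>u. F u y - F u 0" 0] p False show ?thesis
      by (simp add: per1 R_def algebra_simps sum_subtractf)
  qed
  have "(\<Sum>b\<in>{0..<p}. \<Sum>t\<in>{0..<p}. F ((1 - b * t) * (x + b * y)) (t * (x + b * y)) - F (- b * t * (x + b * y)) (t * (x + b * y)))
     = (\<Sum>b\<in>{0..<p}. \<Sum>t\<in>{0..<p}. F (x + b * y - b * t) t - F (- b * t) t)"
    by (rule sum.cong[OF refl], rule A)
  also have "\<dots> = (\<Sum>t\<in>{0..<p}. \<Sum>b\<in>{0..<p}. F (x + b * y - b * t) t) - (\<Sum>t\<in>{0..<p}. \<Sum>b\<in>{0..<p}. F (- b * t) t)"
    by (subst sum.swap) (simp add: sum_subtractf)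
  finally show ?thesis using S1 S2 S3 by simp
qed

text \<open>
  The affine combinations of the first \<open>n\<close> coordinates with integer coefficients of sum 1, in
  a form matching the step \<open>w \<mapsto> w - w2 + w1\<close> that a Mal'cev operation can perform.
\<close>
inductive aff :: "nat \<Rightarrow> ((nat \<Rightarrow> int) \<Rightarrow> int) \<Rightarrow> bool" for n where
  aff_var: "i < n \<Longrightarrow> aff n (\<lambda>v. v i)"
| aff_comb: "aff n w \<Longrightarrow> aff n w1 \<Longrightarrow> aff n w2 \<Longrightarrow> aff n (\<lambda>v. w v + c * (w1 v - w2 v))"

text \<open>
  Functions \<open>(\<int>/q)^k \<rightarrow> \<int>/l\<close> are represented by integer functions read modulo \<open>l\<close>, whose arguments matter only
  modulo \<open>q\<close> and only in the first \<open>k\<close> places.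
\<close>
locale clonoid =
  fixes S :: "nat \<Rightarrow> ((nat \<Rightarrow> int) \<Rightarrow> int) set" and q l :: int
  assumes diff: "d \<in> S k \<Longrightarrow> d' \<in> S k \<Longrightarrow> (\<lambda>v. d v - d' v) \<in> S k"
    and subst: "d \<in> S k \<Longrightarrow> 0 < n \<Longrightarrow> (\<And>i. i < k \<Longrightarrow> aff n (w i)) \<Longrightarrow> (\<lambda>v. d (\<lambda>i. w i v)) \<in> S n"
    and cong: "d \<in> S k \<Longrightarrow> (\<And>v. [d v = d' v] (mod l)) \<Longrightarrow> d' \<in> S k"
    and periodic: "d \<in> S k \<Longrightarrow> (\<And>i. i < k \<Longrightarrow> [v i = v' i] (mod q)) \<Longrightarrow> [d v = d v'] (mod l)"
begin

lemma zero: "d \<in> S k \<Longrightarrow> (\<lambda>v. 0) \<in> S k"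
  using diff[of d k d] by simp

lemma add: "d \<in> S k \<Longrightarrow> d' \<in> S k \<Longrightarrow> (\<lambda>v. d v + d' v) \<in> S k"
  using diff[OF _ diff[OF zero], of d k d' d'] by simp

lemma setsum:
  assumes "d \<in> S k" "\<And>i. i \<in> I \<Longrightarrow> h i \<in> S k"
  shows "(\<lambda>v. \<Sum>i\<in>I. h i v) \<in> S k"
  using assms(2) by (induction I rule: infinite_finite_induct) (auto intro: zero[OF assms(1)] add)

lemma scale:
  fixes a :: int
  assumes "d \<in> S k" shows "(\<lambda>v. a * d v) \<in> S k"
proof -
  have nat: "(\<lambda>v. int m * d v) \<in> S k" for m
    by (induction m) (auto simp: ring_distribs intro: zero add assms)
  show ?thesis
  proof (cases "a \<ge> 0")
    case True then show ?thesis using nat[of "nat a"] by simp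
  next
    case False then show ?thesis using diff[OF zero[OF assms] nat[of "nat (- a)"]] by simp
  qed
qed

lemma divide:
  fixes a :: int
  assumes "(\<lambda>v. a * d v) \<in> S k" and "coprime a l" shows "d \<in> S k"
proof -
  obtain b where b: "[a * b = 1] (mod l)" using cong_solve_coprime_int[OF assms(2)] by blast
  have "(\<lambda>v. b * (a * d v)) \<in> S k" using scale[OF assms(1)] .
  moreover have "[b * (a * d v) = d v] (mod l)" for v
    using cong_scalar_right[OF b, of "d v"] by (simp add: mult_ac)
  ultimately show ?thesis by (rule cong)
qed

end

text \<open>
  Period 1 means that, modulo \<open>l\<close>, the value does not depend on the \<open>j\<close>-th argument.
\<close>
definition period :: "int \<Rightarrow> ((nat \<Rightarrow> int) \<Rightarrow> int) \<Rightarrow> nat \<Rightarrow> int \<Rightarrow> bool" where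
  "period l d j c \<longleftrightarrow> (\<forall>v u. [d (v(j := v j + c * u)) = d v] (mod l))"

text \<open>
  By the Chinese remainder theorem, \<open>e\<close> projects \<open>\<int>/q\<close> onto its \<open>p\<close>-component.
\<close>
lemma prime_idempotent:
  fixes p q :: int
  assumes "prime p" "p dvd q" "squarefree q"
  obtains e where "q dvd p * e" "q dvd e * (1 - e)" "p dvd 1 - e"
proof -
  obtain r where r: "q = p * r" using assms(2) by auto
  have "\<not> p dvd r"
  proof
    assume "p dvd r"
    then have "p ^ 2 dvd q" using r by (simp add: power2_eq_square)
    then have "p dvd 1" using assms(3) by (rule squarefreeD[rotated])
    then show False using assms(1) by (simp add: not_prime_unit)
  qed
  then have "coprime r p" using assms(1) by (metis coprime_commute prime_imp_coprime)
  then obtain s where s: "[r * s = 1] (mod p)" using cong_solve_coprime_int by blast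
  then have "p dvd 1 - r * s" by (metis cong_iff_dvd_diff cong_sym)
  then show thesis by (intro that[of "r * s"]) (auto simp: r mult_dvd_mono mult_ac)
qed

text \<open>
  Take the zeroth argument as origin. The line decomposition, applied to the \<open>p\<close>-components of the first and
  the \<open>j\<close>-th argument, expresses \<open>p d\<close> through functions of the form \<open>K r s\<close> with a
  combination \<open>L\<close> substituted for the first argument. In \<open>K r s\<close> the \<open>p\<close>-component of
  both arguments is read off from the first one, so that the period in the \<open>j\<close>-th argument loses a factor \<open>p\<close>, while
  the arguments after it still do not matter.
\<close>
lemma refine_period:
  fixes q l p c :: int
  assumes S: "clonoid S q l" and S': "clonoid S' q l"
    and q: "squarefree q" "coprime q l" and p: "prime p" "p dvd c" "c dvd q"
    and d: "d \<in> S k" and j: "2 \<le> j" "j < k"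
    and perj: "period l d j c" and per: "\<And>i. j < i \<Longrightarrow> i < k \<Longrightarrow> period l d i 1"
    and IH: "\<And>K. K \<in> S k \<Longrightarrow> period l K j (c div p) \<Longrightarrow> (\<And>i. j < i \<Longrightarrow> i < k \<Longrightarrow> period l K i 1) \<Longrightarrow> K \<in> S' k"
  shows "d \<in> S' k"
proof -
  interpret S: clonoid S q l by fact
  interpret S': clonoid S' q l by fact
  have pq: "p dvd q" using p dvd_trans by blast
  obtain e where e: "q dvd p * e" "q dvd e * (1 - e)" "p dvd 1 - e"
    using prime_idempotent[OF p(1) pq q(1)] by blast
  define K where "K r s = (\<lambda>v. d (v(1 := v 0 + (1 - e + r * e) * (v 1 - v 0),
      j := v 0 + (1 - e) * (v j - v 0) + s * e * (v 1 - v 0))))" for r s :: int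
  have K_S: "K r s \<in> S k" for r s
  proof -
    let ?w = "\<lambda>i v. if i = j then v 0 + (1 - e) * (v j - v 0) + s * e * (v 1 - v 0)
       else if i = 1 then v 0 + (1 - e + r * e) * (v 1 - v 0) else (v i :: int)"
    have "(\<lambda>v. d (\<lambda>i. ?w i v)) \<in> S k"
    proof (rule S.subst[OF d])
      show "aff k (?w i)" if "i < k" for i
        using that j by (cases "i = j"; cases "i = 1") (auto intro!: aff.intros)
    qed (use j in simp)
    moreover have "(\<lambda>i. ?w i v) = v(1 := v 0 + (1 - e + r * e) * (v 1 - v 0),
      j := v 0 + (1 - e) * (v j - v 0) + s * e * (v 1 - v 0))" for v
      by (rule ext) auto
    ultimately show ?thesis by (simp add: K_def)
  qed
  have K_S': "K r s \<in> S' k" for r s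
  proof (rule IH[OF K_S])
    obtain a where a: "1 - e = p * a" using e(3) by auto
    obtain c' where c': "c = p * c'" using p(2) by auto
    have cp: "c div p = c'" using c' p(1) by auto
    show "period l (K r s) j (c div p)"
      unfolding period_def
    proof (intro allI)
      fix v :: "nat \<Rightarrow> int" and u
      define v1 where "v1 = v(1 := v 0 + (1 - e + r * e) * (v 1 - v 0),
        j := v 0 + (1 - e) * (v j - v 0) + s * e * (v 1 - v 0))"
      have eq: "(1 - e) * (c' * u) = c * (a * u)" by (simp add: a c' mult_ac)
      have "K r s (v(j := v j + c div p * u)) = d (v1(j := v1 j + (1 - e) * (c' * u)))"
        unfolding K_def v1_def cp using j by (intro arg_cong[where f = d]) (auto simp: fun_eq_iff algebra_simps)
      also have "\<dots> = d (v1(j := v1 j + c * (a * u)))" by (simp only: eq)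
      also have "[\<dots> = d v1] (mod l)" using perj by (auto simp: period_def)
      finally show "[K r s (v(j := v j + c div p * u)) = K r s v] (mod l)" by (simp only: K_def v1_def)
    qed
    fix i assume i: "j < i" "i < k"
    show "period l (K r s) i 1"
      unfolding period_def
    proof (intro allI)
      fix v :: "nat \<Rightarrow> int" and u
      define v1 where "v1 = v(1 := v 0 + (1 - e + r * e) * (v 1 - v 0),
        j := v 0 + (1 - e) * (v j - v 0) + s * e * (v 1 - v 0))"
      have "K r s (v(i := v i + 1 * u)) = d (v1(i := v1 i + 1 * u))"
        unfolding K_def v1_def using i j by (intro arg_cong[where f = d]) (auto simp: fun_eq_iff)
      also have "[\<dots> = d v1] (mod l)" using per[OF i] unfolding period_def by blast
      finally show "[K r s (v(i := v i + 1 * u)) = K r s v] (mod l)" by (simp only: K_def v1_def)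
    qed
  qed
  \<comment> \<open>With \<open>X = v 1 - v 0\<close> and \<open>Y = v j - v 0\<close>, the \<open>p\<close>-components of \<open>L1 b - v 0\<close> and \<open>L2 - v 0\<close>
    are those of \<open>X + b Y\<close> and of \<open>Y\<close>; all other components are those of \<open>X\<close>.\<close>
  define L1 where "L1 b = (\<lambda>v :: nat \<Rightarrow> int. v 1 + (b * e) * (v j - v 0))" for b
  define L2 where "L2 = (\<lambda>v :: nat \<Rightarrow> int. (v 0 + (1 - e) * (v 1 - v 0)) + e * (v j - v 0))"
  define G where "G r s L = (\<lambda>v. K r s (v(1 := L v)))" for r s and L :: "(nat \<Rightarrow> int) \<Rightarrow> int"
  have G_S': "G r s L \<in> S' k" if "aff k L" for r s L
  proof -
    have "(\<lambda>v. K r s (\<lambda>i. (if i = 1 then L else (\<lambda>v. v i)) v)) \<in> S' k"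
      by (rule S'.subst[OF K_S']) (use j that in \<open>auto intro!: aff.intros\<close>)
    moreover have "(\<lambda>i. (if i = 1 then L else (\<lambda>v. v i)) v) = v(1 := L v)" for v
      by (rule ext) auto
    ultimately show ?thesis by (simp add: G_def)
  qed
  have affL: "aff k (L1 b)" "aff k L2" for b
    unfolding L1_def L2_def using j by (auto intro!: aff.intros)
  have main: "[p * d v = p * K 0 0 v
      + (\<Sum>b\<in>{0..<p}. \<Sum>t\<in>{0..<p}. G (1 - b * t) t (L1 b) v - G (- b * t) t (L1 b) v)
      + (\<Sum>t\<in>{0..<p}. G t 1 L2 v - G t 0 L2 v)] (mod l)" for v
  proof -
    define X where "X = v 1 - v 0"
    define Y where "Y = v j - v 0"
    define P where "P u t = v(1 := v 0 + (1 - e) * X + e * u, j := v 0 + (1 - e) * Y + e * t)" for u t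
    define F where "F u t = d (P (u mod p) (t mod p))" for u t
    have per_q: "[e * (u mod p) = e * u] (mod q)" for u
    proof -
      have "e * u - e * (u mod p) = (p * e) * (u div p)"
        by (simp add: minus_mod_eq_mult_div[symmetric] mult.assoc mult.left_commute right_diff_distrib[symmetric])
      then show ?thesis using e(1) by (metis cong_iff_dvd_diff cong_sym dvd_mult2)
    qed
    have FP: "[F u t = d (P u t)] (mod l)" for u t
      unfolding F_def by (rule S.periodic[OF d]) (auto simp: P_def intro!: cong_add per_q)
    have Gval: "[F (r * W) (s * W) = G r s L v] (mod l)"
      if "[e * (L v - v 0) = e * W] (mod q)" "[(1 - e) * (L v - v 0) = (1 - e) * X] (mod q)" for r s W L
    proof -
      have "[P (r * W) (s * W) i = (v(1 := v 0 + (1 - e + r * e) * (L v - v 0),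
          j := v 0 + (1 - e) * (v j - v 0) + s * e * (L v - v 0))) i] (mod q)" for i
      proof -
        have "[v 0 + ((1 - e) * X + r * (e * W)) = v 0 + ((1 - e) * (L v - v 0) + r * (e * (L v - v 0)))] (mod q)"
          by (intro cong_add cong_refl cong_mult[OF cong_refl] that[THEN cong_sym]) 
        moreover have "[v 0 + (1 - e) * Y + s * (e * W) = v 0 + (1 - e) * Y + s * (e * (L v - v 0))] (mod q)"
          by (intro cong_add cong_refl cong_mult[OF cong_refl] that[THEN cong_sym])
        ultimately show ?thesis
          by (auto simp: P_def Y_def algebra_simps)
      qed
      then have "[d (P (r * W) (s * W)) = d (v(1 := v 0 + (1 - e + r * e) * (L v - v 0),
          j := v 0 + (1 - e) * (v j - v 0) + s * e * (L v - v 0)))] (mod l)"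
        by (intro S.periodic[OF d])
      moreover have "G r s L v = d (v(1 := v 0 + (1 - e + r * e) * (L v - v 0),
          j := v 0 + (1 - e) * (v j - v 0) + s * e * (L v - v 0)))"
        unfolding G_def K_def using j by (intro arg_cong[where f = d]) (auto simp: fun_eq_iff)
      ultimately show ?thesis using FP[of "r * W" "s * W"] cong_trans by metis
    qed
    obtain z where z: "e * (1 - e) = q * z" using e(2) by auto
    have GL1: "[F (r * (X + b * Y)) (s * (X + b * Y)) = G r s (L1 b) v] (mod l)" for r s b
    proof (rule Gval)
      have "e * (X + b * Y) - e * (L1 b v - v 0) = q * (z * b * Y)"
        unfolding L1_def X_def Y_def mult.assoc[symmetric] z[symmetric] by (simp add: algebra_simps)
      then show "[e * (L1 b v - v 0) = e * (X + b * Y)] (mod q)"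
        by (metis cong_iff_dvd_diff cong_sym dvd_triv_left)
      have "(1 - e) * (L1 b v - v 0) - (1 - e) * X = q * (z * b * Y)"
        unfolding L1_def X_def Y_def mult.assoc[symmetric] z[symmetric] by (simp add: algebra_simps)
      then show "[(1 - e) * (L1 b v - v 0) = (1 - e) * X] (mod q)"
        by (metis cong_iff_dvd_diff dvd_triv_left)
    qed
    have GL2: "[F (r * Y) (s * Y) = G r s L2 v] (mod l)" for r s
    proof (rule Gval)
      have "e * (L2 v - v 0) - e * Y = q * (z * (X - Y))"
        unfolding L2_def X_def Y_def mult.assoc[symmetric] z[symmetric] by (simp add: algebra_simps)
      then show "[e * (L2 v - v 0) = e * Y] (mod q)"
        by (metis cong_iff_dvd_diff dvd_triv_left)
      have "(1 - e) * X - (1 - e) * (L2 v - v 0) = q * (z * (X - Y))"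
        unfolding L2_def X_def Y_def mult.assoc[symmetric] z[symmetric] by (simp add: algebra_simps)
      then show "[(1 - e) * (L2 v - v 0) = (1 - e) * X] (mod q)"
        by (metis cong_iff_dvd_diff cong_sym dvd_triv_left)
    qed
    have "G 0 0 (\<lambda>v. v 1) v = K 0 0 v" by (simp add: G_def)
    with Gval[of "\<lambda>v. v 1" X 0 0] have F0: "[F 0 0 = K 0 0 v] (mod l)" by (simp add: X_def)
    have "P X Y = v" unfolding P_def X_def Y_def by (auto simp: fun_eq_iff algebra_simps)
    with FP[of X Y] have FXY: "[F X Y = d v] (mod l)" by simp
    have lines: "p * F X Y = p * F 0 0
      + (\<Sum>b\<in>{0..<p}. \<Sum>t\<in>{0..<p}. F ((1 - b * t) * (X + b * Y)) (t * (X + b * Y)) - F (- b * t * (X + b * Y)) (t * (X + b * Y)))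
      + (\<Sum>t\<in>{0..<p}. F (t * Y) (1 * Y) - F (t * Y) (0 * Y))"
      using line_decomposition[of p F X Y] p(1) by (simp add: F_def)
    have "[p * F X Y = p * K 0 0 v
      + (\<Sum>b\<in>{0..<p}. \<Sum>t\<in>{0..<p}. G (1 - b * t) t (L1 b) v - G (- b * t) t (L1 b) v)
      + (\<Sum>t\<in>{0..<p}. G t 1 L2 v - G t 0 L2 v)] (mod l)"
      unfolding lines
    proof (rule cong_add[OF cong_add])
      show "[p * F 0 0 = p * K 0 0 v] (mod l)" by (rule cong_mult[OF cong_refl F0])
    qed (rule cong_sum cong_diff GL1 GL2)+
    then show ?thesis
      by (rule cong_trans[OF cong_mult[OF cong_refl cong_sym[OF FXY]]])
  qed
  have "(\<lambda>v. p * K 0 0 v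
      + (\<Sum>b\<in>{0..<p}. \<Sum>t\<in>{0..<p}. G (1 - b * t) t (L1 b) v - G (- b * t) t (L1 b) v)
      + (\<Sum>t\<in>{0..<p}. G t 1 L2 v - G t 0 L2 v)) \<in> S' k"
    by (intro S'.add S'.setsum[OF K_S'[of 0 0]] S'.diff S'.scale G_S' K_S' affL)
  then have "(\<lambda>v. p * d v) \<in> S' k"
    by (rule S'.cong) (rule cong_sym[OF main])
  moreover have "coprime p l" by (rule coprime_divisors[OF pq dvd_refl q(2)])
  ultimately show ?thesis by (rule S'.divide)
qed

text \<open>
  Each refinement divides the period \<open>c\<close> by a prime, so that finally it is 1.
\<close>
lemma remove_variable:
  fixes q l c :: int
  assumes S: "clonoid S q l" and S': "clonoid S' q l"
    and q: "squarefree q" "coprime q l" and j: "2 \<le> j" "j < k"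
    and dead: "\<And>d. d \<in> S k \<Longrightarrow> (\<And>i. j \<le> i \<Longrightarrow> i < k \<Longrightarrow> period l d i 1) \<Longrightarrow> d \<in> S' k"
    and "c dvd q" "c > 0"
    and "d \<in> S k" "period l d j c" "\<And>i. j < i \<Longrightarrow> i < k \<Longrightarrow> period l d i 1"
  shows "d \<in> S' k"
  using assms(8-12)
proof (induction "nat c" arbitrary: c d rule: less_induct)
  case (less c d)
  show ?case
  proof (cases "c = 1")
    case True
    then show ?thesis using dead[OF less.prems(3)] less.prems(4,5) by (metis le_neq_implies_less)
  next
    case False
    then have "\<not> is_unit c" using less.prems(2) by simp
    then obtain p where p: "prime p" "p dvd c"
      using less.prems(2) prime_divisor_exists[of c] by auto
    then obtain c' where c': "c = p * c'" by auto
    have p1: "p > 1" using p(1) by (simp add: prime_gt_1_int)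
    have c'0: "c' > 0" using less.prems(2) c' p1 by (simp add: zero_less_mult_iff)
    have lt: "c' < c" using c' p1 c'0 by simp
    have "c div p = c'" using c' p1 by simp
    moreover have "c' dvd q" using c' less.prems(1) by (metis dvd_mult_right)
    ultimately show ?thesis
      using less.hyps[of c'] lt c'0 less.prems
      by (intro refine_period[OF S S' q p less.prems(1,3) j less.prems(4,5)]) auto
  qed
qed

text \<open>
  Every argument has period \<open>q\<close>. Removing the arguments \<open>2, \<dots>, k - 1\<close> in turn reduces the claim to functions that
  depend on arguments 0 and 1 only, which are substitution instances of binary ones.
\<close>
theorem clonoid_determined_by_binary:
  fixes q l :: int
  assumes S: "clonoid S q l" and S': "clonoid S' q l"
    and q: "squarefree q" "coprime q l" "q > 0" and binary: "S 2 \<subseteq> S' 2"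
    and d: "d \<in> S k" and k: "1 \<le> k"
  shows "d \<in> S' k"
proof -
  interpret S: clonoid S q l by fact
  interpret S': clonoid S' q l by fact
  show ?thesis
  proof (cases "k = 1")
    case True
    have "(\<lambda>v. d (\<lambda>i. v 0)) \<in> S 2"
      by (rule S.subst[OF d]) (auto intro: aff_var)
    then have "(\<lambda>v. d (\<lambda>i. v 0)) \<in> S' 2" using binary by auto
    then have "(\<lambda>v. d (\<lambda>i. v 0)) \<in> S' k"
      by (rule S'.subst) (auto simp: True intro: aff_var)
    moreover have "[d (\<lambda>i. v 0) = d v] (mod l)" for v
      by (rule S.periodic[OF d]) (simp add: True)
    ultimately show ?thesis by (rule S'.cong)
  next
    case False
    with k have k2: "2 \<le> k" by simp
    have "d \<in> S' k" if "2 \<le> m" "m \<le> k" "d \<in> S k" "\<And>i. m \<le> i \<Longrightarrow> i < k \<Longrightarrow> period l d i 1" for m d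
      using that
    proof (induction m arbitrary: d rule: nat_induct_at_least)
      \<comment> \<open>None of the arguments from 2 on matters, so they may all be replaced by argument 0.\<close>
      case base
      note d = base(2)
      have "(\<lambda>v. d (\<lambda>i. (if i = 1 then v 1 else v 0))) \<in> S 2"
      proof (rule S.subst[OF d])
        show "aff 2 (\<lambda>v. if i = 1 then v 1 else v 0)" for i :: nat
          by (cases "i = 1") (auto intro: aff_var)
      qed simp
      then have "(\<lambda>v. d (\<lambda>i. (if i = 1 then v 1 else v 0))) \<in> S' 2" using binary by auto
      then have "(\<lambda>v. d (\<lambda>i. (if i = 1 then v 1 else v 0))) \<in> S' k"
        by (rule S'.subst[of "\<lambda>v. d (\<lambda>i. (if i = 1 then v 1 else v 0))" 2 k "\<lambda>i v. v i"])
          (use k2 in \<open>auto intro: aff_var\<close>)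
      moreover have "[d (\<lambda>i. (if i = 1 then v 1 else v 0)) = d v] (mod l)" for v
      proof -
        have "[d (\<lambda>i. (if 2 \<le> i \<and> i < j then v 0 else v i)) = d v] (mod l)" if "2 \<le> j" "j \<le> k" for j
          using that
        proof (induction j rule: nat_induct_at_least)
          case base
          show ?case by (rule S.periodic[OF d]) auto
        next
          case (Suc j)
          let ?v = "\<lambda>i. (if 2 \<le> i \<and> i < j then v 0 else v i)"
          have "period l d j 1" using base(3)[of j] Suc by simp
          then have "[d (?v(j := ?v j + 1 * (v 0 - ?v j))) = d ?v] (mod l)" unfolding period_def by blast
          moreover have "?v(j := ?v j + 1 * (v 0 - ?v j)) = (\<lambda>i. (if 2 \<le> i \<and> i < Suc j then v 0 else v i))"
            using Suc.hyps by (auto simp: fun_eq_iff)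
          ultimately have "[d (\<lambda>i. (if 2 \<le> i \<and> i < Suc j then v 0 else v i)) = d ?v] (mod l)" by simp
          then show ?case using Suc.IH Suc.prems by (metis (no_types, lifting) Suc_leD cong_trans)
        qed
        from this[OF k2] have "[d (\<lambda>i. (if 2 \<le> i \<and> i < k then v 0 else v i)) = d v] (mod l)" by simp
        moreover have "[d (\<lambda>i. (if i = 1 then v 1 else v 0)) = d (\<lambda>i. (if 2 \<le> i \<and> i < k then v 0 else v i))] (mod l)"
        proof (rule S.periodic[OF d])
          fix i assume "i < k"
          consider "i = 0" | "i = 1" | "2 \<le> i" by linarith
          then show "[(if i = 1 then v 1 else v 0) = (if 2 \<le> i \<and> i < k then v 0 else v i)] (mod q)"
            using \<open>i < k\<close> by cases auto
        qed
        ultimately show ?thesis using cong_trans by blast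
      qed
      ultimately show ?case by (rule S'.cong)
    next
      case (Suc m)
      have "period l d m q"
        unfolding period_def by (intro allI S.periodic[OF Suc.prems(2)]) (auto simp: cong_iff_dvd_diff)
      show ?case
      proof (rule remove_variable[OF S S' q(1,2) Suc.hyps, of k q d])
        show "m < k" using Suc.prems by simp
        show "d' \<in> S' k" if "d' \<in> S k" "\<And>i. m \<le> i \<Longrightarrow> i < k \<Longrightarrow> period l d' i 1" for d'
          using Suc.IH[of d'] that Suc.prems by simp
        show "period l d i 1" if "m < i" "i < k" for i using Suc.prems that by simp
      qed (use \<open>period l d m q\<close> Suc.prems q in auto)
    qed
    from this[OF k2 order_refl d] show ?thesis by simp
  qed
qed

section \<open>Generation by ternary operations\<close>

text \<open>
  Abstracting from the congruence: being in the same block means having the same \<open>\<chi>\<close>.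
\<close>
locale coordinatized_algebra =
  fixes A :: "('s, 'a) ualg" and M :: "'a \<Rightarrow> 'a \<Rightarrow> 'a \<Rightarrow> 'a" and q l :: int and \<chi> \<kappa> :: "'a \<Rightarrow> int"
  assumes ualg: "is_ualg A"
    and M_op: "term_op A 3 (\<lambda>xs. M (xs ! 0) (xs ! 1) (xs ! 2))"
    and malcev_right: "\<And>x y. x \<in> carrier A \<Longrightarrow> y \<in> carrier A \<Longrightarrow> M x y y = x"
    and malcev_left: "\<And>x y. x \<in> carrier A \<Longrightarrow> y \<in> carrier A \<Longrightarrow> M y y x = x"
    and \<chi>_range: "\<And>x. x \<in> carrier A \<Longrightarrow> \<chi> x \<in> {0..<q}"
    and \<kappa>_range: "\<And>x. x \<in> carrier A \<Longrightarrow> \<kappa> x \<in> {0..<l}"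
    and \<chi>_surj: "\<And>a. a \<in> {0..<q} \<Longrightarrow> \<exists>x\<in>carrier A. \<chi> x = a"
    and coordinates_inj: "\<And>x y. x \<in> carrier A \<Longrightarrow> y \<in> carrier A \<Longrightarrow> \<chi> x = \<chi> y \<Longrightarrow> \<kappa> x = \<kappa> y \<Longrightarrow> x = y"
    and \<chi>_M: "\<And>x y z. x \<in> carrier A \<Longrightarrow> y \<in> carrier A \<Longrightarrow> z \<in> carrier A \<Longrightarrow>
      [\<chi> (M x y z) = \<chi> x - \<chi> y + \<chi> z] (mod q)"
    and \<kappa>_M: "\<And>x y z. x \<in> carrier A \<Longrightarrow> y \<in> carrier A \<Longrightarrow> z \<in> carrier A \<Longrightarrow> \<chi> x = \<chi> y \<Longrightarrow>
      [\<kappa> (M x y z) = \<kappa> x - \<kappa> y + \<kappa> z] (mod l)"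
    and \<chi>_cong: "\<And>k f x y. term_op A k f \<Longrightarrow> (\<And>i. i < k \<Longrightarrow> x i \<in> carrier A) \<Longrightarrow>
      (\<And>i. i < k \<Longrightarrow> y i \<in> carrier A) \<Longrightarrow> (\<And>i. i < k \<Longrightarrow> \<chi> (x i) = \<chi> (y i)) \<Longrightarrow>
      \<chi> (f (map x [0..<k])) = \<chi> (f (map y [0..<k]))"
    and \<chi>_affine: "\<And>k f x y z. term_op A k f \<Longrightarrow> (\<And>i. i < k \<Longrightarrow> x i \<in> carrier A) \<Longrightarrow>
      (\<And>i. i < k \<Longrightarrow> y i \<in> carrier A) \<Longrightarrow> (\<And>i. i < k \<Longrightarrow> z i \<in> carrier A) \<Longrightarrow>
      \<chi> (f (map (\<lambda>i. M (x i) (y i) (z i)) [0..<k])) =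
      \<chi> (M (f (map x [0..<k])) (f (map y [0..<k])) (f (map z [0..<k])))"
    and central: "\<And>k f x y z. term_op A k f \<Longrightarrow> (\<And>i. i < k \<Longrightarrow> x i \<in> carrier A) \<Longrightarrow>
      (\<And>i. i < k \<Longrightarrow> y i \<in> carrier A) \<Longrightarrow> (\<And>i. i < k \<Longrightarrow> z i \<in> carrier A) \<Longrightarrow>
      (\<And>i. i < k \<Longrightarrow> \<chi> (x i) = \<chi> (y i)) \<Longrightarrow>
      f (map (\<lambda>i. M (x i) (y i) (z i)) [0..<k]) =
      M (f (map x [0..<k])) (f (map y [0..<k])) (f (map z [0..<k]))"
begin

lemma M_closed: "x \<in> carrier A \<Longrightarrow> y \<in> carrier A \<Longrightarrow> z \<in> carrier A \<Longrightarrow> M x y z \<in> carrier A"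
  using term_op_closed[OF ualg M_op, of "[x, y, z]"] by (simp add: tuples_def)

lemma closed: "term_op A k f \<Longrightarrow> (\<And>i. i < k \<Longrightarrow> x i \<in> carrier A) \<Longrightarrow> f (map x [0..<k]) \<in> carrier A"
  by (rule term_op_closed[OF ualg]) (auto intro: map_upt_in_tuples)

lemma term_op_M:
  assumes "term_op A k F" "term_op A k G" "term_op A k H"
  shows "term_op A k (\<lambda>xs. M (F xs) (G xs) (H xs))"
proof -
  have "term_op A k (\<lambda>w. (\<lambda>xs. M (xs ! 0) (xs ! 1) (xs ! 2)) (map (\<lambda>i. ([F, G, H] ! i) w) [0..<3]))"
    by (rule term_op_comp[OF ualg M_op])
      (use assms term_op_arity_pos[OF ualg assms(1)] in \<open>auto simp: less_Suc_eq numeral_3_eq_3\<close>)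
  then show ?thesis by (rule term_op_cong) simp
qed

lemma \<chi>_eqI: "x \<in> carrier A \<Longrightarrow> y \<in> carrier A \<Longrightarrow> [\<chi> x = \<chi> y] (mod q) \<Longrightarrow> \<chi> x = \<chi> y"
  using \<chi>_range[of x] \<chi>_range[of y] by (simp add: cong_def)

lemma \<kappa>_eqI: "x \<in> carrier A \<Longrightarrow> y \<in> carrier A \<Longrightarrow> [\<kappa> x = \<kappa> y] (mod l) \<Longrightarrow> \<kappa> x = \<kappa> y"
  using \<kappa>_range[of x] \<kappa>_range[of y] by (simp add: cong_def)

lemma \<chi>_M_eq:
  assumes "x \<in> carrier A" "y \<in> carrier A" "z \<in> carrier A" "\<chi> x = \<chi> y"
  shows "\<chi> (M x y z) = \<chi> z"
  using \<chi>_M[OF assms(1-3)] assms by (intro \<chi>_eqI M_closed) auto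

lemma \<kappa>_translate:
  assumes "term_op A k f" "\<And>i. i < k \<Longrightarrow> x i \<in> carrier A" "\<And>i. i < k \<Longrightarrow> y i \<in> carrier A"
    "\<And>i. i < k \<Longrightarrow> z i \<in> carrier A" "\<And>i. i < k \<Longrightarrow> \<chi> (x i) = \<chi> (y i)"
  shows "[\<kappa> (f (map (\<lambda>i. M (x i) (y i) (z i)) [0..<k])) =
    \<kappa> (f (map x [0..<k])) - \<kappa> (f (map y [0..<k])) + \<kappa> (f (map z [0..<k]))] (mod l)"
proof -
  have "f (map (\<lambda>i. M (x i) (y i) (z i)) [0..<k]) =
      M (f (map x [0..<k])) (f (map y [0..<k])) (f (map z [0..<k]))"
    by (rule central[OF assms])
  moreover have "\<chi> (f (map x [0..<k])) = \<chi> (f (map y [0..<k]))"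
    by (rule \<chi>_cong[OF assms(1-3,5)])
  ultimately show ?thesis using closed[OF assms(1)] assms(2-4) \<kappa>_M by simp
qed

lemma central_M:
  assumes "{x1, x2, x3, y1, y2, y3, z1, z2, z3} \<subseteq> carrier A" "\<chi> x1 = \<chi> y1" "\<chi> x2 = \<chi> y2" "\<chi> x3 = \<chi> y3"
  shows "M (M x1 y1 z1) (M x2 y2 z2) (M x3 y3 z3) = M (M x1 x2 x3) (M y1 y2 y3) (M z1 z2 z3)"
proof -
  let ?x = "\<lambda>i. [x1, x2, x3] ! i" and ?y = "\<lambda>i. [y1, y2, y3] ! i" and ?z = "\<lambda>i. [z1, z2, z3] ! i"
  have *: "?x i \<in> carrier A \<and> ?y i \<in> carrier A \<and> ?z i \<in> carrier A \<and> \<chi> (?x i) = \<chi> (?y i)" if "i < 3" for i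
    using that assms by (auto simp: less_Suc_eq numeral_3_eq_3)
  show ?thesis using central[OF M_op, of ?x ?y ?z] * by (simp add: upt_rec)
qed

lemma \<chi>_M_cong:
  assumes "{x1, x2, x3, y1, y2, y3} \<subseteq> carrier A" "\<chi> x1 = \<chi> y1" "\<chi> x2 = \<chi> y2" "\<chi> x3 = \<chi> y3"
  shows "\<chi> (M x1 x2 x3) = \<chi> (M y1 y2 y3)"
proof -
  let ?x = "\<lambda>i. [x1, x2, x3] ! i" and ?y = "\<lambda>i. [y1, y2, y3] ! i"
  have *: "?x i \<in> carrier A \<and> ?y i \<in> carrier A \<and> \<chi> (?x i) = \<chi> (?y i)" if "i < 3" for i
    using that assms by (auto simp: less_Suc_eq numeral_3_eq_3)
  show ?thesis using \<chi>_cong[OF M_op, of ?x ?y] * by (simp add: upt_rec)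
qed

text \<open>
  Although \<open>\<kappa>\<close> of \<open>M x y z\<close> involves an unknown function of the blocks of the arguments, its change under
  moving the arguments inside their blocks is linear. Up to the summand \<open>\<kappa> w\<close>, both sides compute \<open>\<kappa>\<close> of
  \<open>M (x - x' + w) (y - y' + w) (z - z' + w)\<close>, here with \<open>w = x\<close>.
\<close>
lemma \<kappa>_M_diff:
  assumes X: "{x, y, z, x', y', z'} \<subseteq> carrier A" and "\<chi> x = \<chi> x'" "\<chi> y = \<chi> y'" "\<chi> z = \<chi> z'"
  shows "[\<kappa> (M x y z) - \<kappa> (M x' y' z') = (\<kappa> x - \<kappa> x') - (\<kappa> y - \<kappa> y') + (\<kappa> z - \<kappa> z')] (mod l)"
proof -
  have cl: "M x y z \<in> carrier A" "M x' y' z' \<in> carrier A" "M x x' x \<in> carrier A" "M y y' x \<in> carrier A" "M z z' x \<in> carrier A"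
    using X by (auto intro: M_closed)
  have "M (M x x' x) (M y y' x) (M z z' x) = M (M x y z) (M x' y' z') (M x x x)"
    by (rule central_M) (use assms in auto)
  then have eq: "M (M x x' x) (M y y' x) (M z z' x) = M (M x y z) (M x' y' z') x"
    using X by (simp add: malcev_right)
  have "[\<kappa> (M (M x y z) (M x' y' z') x) = \<kappa> (M x y z) - \<kappa> (M x' y' z') + \<kappa> x] (mod l)"
    by (intro \<kappa>_M cl \<chi>_M_cong) (use assms in auto)
  moreover have "[\<kappa> (M (M x x' x) (M y y' x) (M z z' x)) = \<kappa> (M x x' x) - \<kappa> (M y y' x) + \<kappa> (M z z' x)] (mod l)"
    by (intro \<kappa>_M cl) (use assms \<chi>_M_eq in auto)
  moreover have "[\<kappa> (M x x' x) - \<kappa> (M y y' x) + \<kappa> (M z z' x) =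
      (\<kappa> x - \<kappa> x' + \<kappa> x) - (\<kappa> y - \<kappa> y' + \<kappa> x) + (\<kappa> z - \<kappa> z' + \<kappa> x)] (mod l)"
    by (intro cong_add cong_diff \<kappa>_M) (use assms in auto)
  ultimately have "[\<kappa> (M x y z) - \<kappa> (M x' y' z') + \<kappa> x =
      (\<kappa> x - \<kappa> x' + \<kappa> x) - (\<kappa> y - \<kappa> y' + \<kappa> x) + (\<kappa> z - \<kappa> z' + \<kappa> x)] (mod l)"
    unfolding eq by (metis cong_sym cong_trans)
  then show ?thesis by (simp add: cong_iff_dvd_diff algebra_simps)
qed

text \<open>
  The change of \<open>\<kappa>\<close> of an arbitrary operation, as its arguments move inside their blocks, is
  additive in the displacements and does not depend on where the blocks lie: this is the linear type of
  the operation, without coefficients.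
\<close>
lemma \<kappa>_op_diff:
  assumes f: "term_op A k f"
    and X: "\<And>i. i < k \<Longrightarrow> {x i, y i, z i, x' i, y' i, z' i} \<subseteq> carrier A"
    and \<chi>: "\<And>i. i < k \<Longrightarrow> \<chi> (x i) = \<chi> (x' i)" "\<And>i. i < k \<Longrightarrow> \<chi> (y i) = \<chi> (y' i)" "\<And>i. i < k \<Longrightarrow> \<chi> (z i) = \<chi> (z' i)"
  shows "[\<kappa> (f (map (\<lambda>i. M (x i) (y i) (z i)) [0..<k])) - \<kappa> (f (map (\<lambda>i. M (x' i) (y' i) (z' i)) [0..<k])) =
    (\<kappa> (f (map x [0..<k])) - \<kappa> (f (map x' [0..<k]))) - (\<kappa> (f (map y [0..<k])) - \<kappa> (f (map y' [0..<k])))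
    + (\<kappa> (f (map z [0..<k])) - \<kappa> (f (map z' [0..<k])))] (mod l)"
proof -
  let ?K = "\<lambda>x. \<kappa> (f (map x [0..<k]))"
  define w where "w = x"
  define u where "u i = M (x i) (y i) (z i)" for i
  define u' where "u' i = M (x' i) (y' i) (z' i)" for i
  define a where "a i = M (x i) (x' i) (w i)" for i
  define b where "b i = M (y i) (y' i) (w i)" for i
  define c where "c i = M (z i) (z' i) (w i)" for i
  have cl: "u i \<in> carrier A" "u' i \<in> carrier A" "w i \<in> carrier A" "a i \<in> carrier A" "b i \<in> carrier A" "c i \<in> carrier A" if "i < k" for i
    unfolding u_def u'_def w_def a_def b_def c_def using X[OF that] by (auto intro!: M_closed)
  have \<chi>abc: "\<chi> (a i) = \<chi> (w i)" "\<chi> (b i) = \<chi> (w i)" "\<chi> (c i) = \<chi> (w i)" if "i < k" for i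
    using X[OF that] \<chi>[OF that] \<chi>_M_eq[of "x i" "x' i" "w i"] \<chi>_M_eq[of "y i" "y' i" "w i"]
      \<chi>_M_eq[of "z i" "z' i" "w i"] by (simp_all add: a_def b_def c_def w_def)
  have eq: "M (u i) (u' i) (w i) = M (a i) (b i) (c i)" if "i < k" for i
  proof -
    have "M (a i) (b i) (c i) = M (u i) (u' i) (M (w i) (w i) (w i))"
      unfolding a_def b_def c_def u_def u'_def
      by (rule central_M) (use X[OF that] \<chi>[OF that] in \<open>auto simp: w_def\<close>)
    then show ?thesis using cl[OF that] by (simp add: malcev_right)
  qed
  have 1: "[?K (\<lambda>i. M (u i) (u' i) (w i)) = ?K u - ?K u' + ?K w] (mod l)"
    by (rule \<kappa>_translate[OF f]) (use cl X \<chi> in \<open>auto simp: u_def u'_def intro!: \<chi>_M_cong\<close>)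
  have 2: "[?K (\<lambda>i. M (a i) (b i) (c i)) = ?K a - ?K b + ?K c] (mod l)"
    by (rule \<kappa>_translate[OF f]) (use cl \<chi>abc in auto)
  have 3: "[?K a - ?K b + ?K c = (?K x - ?K x' + ?K w) - (?K y - ?K y' + ?K w) + (?K z - ?K z' + ?K w)] (mod l)"
    unfolding a_def b_def c_def
    by (intro cong_add cong_diff \<kappa>_translate[OF f]) (use X \<chi> in \<open>auto simp: w_def\<close>)
  have 4: "?K (\<lambda>i. M (u i) (u' i) (w i)) = ?K (\<lambda>i. M (a i) (b i) (c i))"
    using eq by (auto intro!: arg_cong[where f = "\<lambda>x. \<kappa> (f x)"])
  have "[?K u - ?K u' + ?K w = (?K x - ?K x' + ?K w) - (?K y - ?K y' + ?K w) + (?K z - ?K z' + ?K w)] (mod l)"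
    using cong_trans[OF cong_sym[OF 1[unfolded 4]] cong_trans[OF 2 3]] .
  moreover have "u = (\<lambda>i. M (x i) (y i) (z i))" "u' = (\<lambda>i. M (x' i) (y' i) (z' i))"
    by (auto simp: u_def u'_def)
  ultimately show ?thesis by (simp add: cong_iff_dvd_diff algebra_simps)
qed

text \<open>
  The integers \<open>v\<close> are coordinates of the blocks of \<open>xs\<close>, taken modulo \<open>q\<close>.
\<close>
definition lies_over :: "nat \<Rightarrow> (nat \<Rightarrow> int) \<Rightarrow> 'a list \<Rightarrow> bool" where
  "lies_over k v xs \<longleftrightarrow> xs \<in> tuples (carrier A) k \<and> (\<forall>i<k. [v i = \<chi> (xs ! i)] (mod q))"

text \<open>
  The operations \<open>f\<close> and \<open>g\<close> have the same linear type; \<open>d\<close> is their difference as a function of the blocks.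
\<close>
definition differences :: "nat \<Rightarrow> ((nat \<Rightarrow> int) \<Rightarrow> int) set" where
  "differences k = {d. \<exists>f g. term_op A k f \<and> term_op A k g \<and>
     (\<forall>v xs. lies_over k v xs \<longrightarrow> \<chi> (f xs) = \<chi> (g xs) \<and> [\<kappa> (f xs) - \<kappa> (g xs) = d v] (mod l))}"

lemma ex_lies_over: "q > 0 \<Longrightarrow> \<exists>xs. lies_over k v xs"
proof -
  assume q: "q > 0"
  have "\<exists>x\<in>carrier A. \<chi> x = v i mod q" for i using q by (intro \<chi>_surj) auto
  then obtain t where t: "\<And>i. t i \<in> carrier A" "\<And>i. \<chi> (t i) = v i mod q" by metis
  have "lies_over k v (map t [0..<k])" using t by (auto simp: lies_over_def)
  then show ?thesis by blast
qed

text \<open>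
  The combination \<open>w + c (w1 - w2)\<close> arises from \<open>w\<close> by \<open>\<bar>c\<bar>\<close> applications of \<open>M\<close>.
\<close>
lemma aff_realized:
  assumes "aff n w"
  shows "\<exists>W. term_op A n W \<and> (\<forall>v xs. lies_over n v xs \<longrightarrow> [w v = \<chi> (W xs)] (mod q))"
  using assms
proof induction
  case (aff_var i)
  then show ?case using term_op_proj[of i n A] by (auto simp: lies_over_def)
next
  case (aff_comb w w1 w2 c)
  let ?R = "\<lambda>w W. term_op A n W \<and> (\<forall>v xs. lies_over n v xs \<longrightarrow> [w v = \<chi> (W xs)] (mod q))"
  obtain W W1 W2 where W: "?R w W" "?R w1 W1" "?R w2 W2" using aff_comb.IH by blast
  have step: "?R (\<lambda>v. w v - w2 v + w1 v) (\<lambda>xs. M (W xs) (W2 xs) (W1 xs))"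
    if "?R w W" "?R w1 W1" "?R w2 W2" for w w1 w2 W W1 W2
  proof (intro conjI allI impI term_op_M)
    fix v xs assume v: "lies_over n v xs"
    then have "W xs \<in> carrier A" "W1 xs \<in> carrier A" "W2 xs \<in> carrier A"
      using that term_op_closed[OF ualg] by (auto simp: lies_over_def)
    then have "[\<chi> (M (W xs) (W2 xs) (W1 xs)) = \<chi> (W xs) - \<chi> (W2 xs) + \<chi> (W1 xs)] (mod q)"
      by (intro \<chi>_M)
    moreover have "[w v - w2 v + w1 v = \<chi> (W xs) - \<chi> (W2 xs) + \<chi> (W1 xs)] (mod q)"
      using that v by (intro cong_add cong_diff) auto
    ultimately show "[w v - w2 v + w1 v = \<chi> (M (W xs) (W2 xs) (W1 xs))] (mod q)"
      by (metis cong_sym cong_trans)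
  qed (use that in auto)
  have iter: "\<exists>U. ?R (\<lambda>v. w v + int m * (w1 v - w2 v)) U" if "?R w1 W1" "?R w2 W2" for w1 w2 W1 W2 m
  proof (induction m)
    case 0
    then show ?case using W(1) by auto
  next
    case (Suc m)
    then obtain U where "?R (\<lambda>v. w v + int m * (w1 v - w2 v)) U" by blast
    from step[OF this that] show ?case by (auto simp: algebra_simps intro!: exI)
  qed
  show ?case
  proof (cases "c \<ge> 0")
    case True
    then show ?thesis using iter[OF W(2,3), of "nat c"] by simp
  next
    case False
    then have "w v + int (nat (- c)) * (w2 v - w1 v) = w v + c * (w1 v - w2 v)" for v
      by (simp add: algebra_simps)
    then show ?thesis using iter[OF W(3,2), of "nat (- c)"] by simp
  qed
qed

text \<open>
  If \<open>d = f - g\<close> and \<open>d' = f' - g'\<close>, then \<open>d - d'\<close> is the difference of \<open>M f g g'\<close> and \<open>f'\<close>: the operation \<open>M\<close> transports a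
  difference from one linear type to another.
\<close>
lemma clonoid_differences:
  assumes q: "q > 0"
  shows "clonoid differences q l"
proof
  fix d d' k assume "d \<in> differences k" "d' \<in> differences k"
  then obtain f g f' g' where ops: "term_op A k f" "term_op A k g" "term_op A k f'" "term_op A k g'"
    and d: "\<And>v xs. lies_over k v xs \<Longrightarrow> \<chi> (f xs) = \<chi> (g xs) \<and> [\<kappa> (f xs) - \<kappa> (g xs) = d v] (mod l)"
    and d': "\<And>v xs. lies_over k v xs \<Longrightarrow> \<chi> (f' xs) = \<chi> (g' xs) \<and> [\<kappa> (f' xs) - \<kappa> (g' xs) = d' v] (mod l)"
    unfolding differences_def by blast
  have "term_op A k (\<lambda>xs. M (f xs) (g xs) (g' xs))" using ops by (intro term_op_M)
  moreover have "\<chi> (M (f xs) (g xs) (g' xs)) = \<chi> (f' xs) \<and>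
      [\<kappa> (M (f xs) (g xs) (g' xs)) - \<kappa> (f' xs) = d v - d' v] (mod l)" if v: "lies_over k v xs" for v xs
  proof
    have cl: "f xs \<in> carrier A" "g xs \<in> carrier A" "g' xs \<in> carrier A"
      using v ops term_op_closed[OF ualg] by (auto simp: lies_over_def)
    show "\<chi> (M (f xs) (g xs) (g' xs)) = \<chi> (f' xs)"
      using \<chi>_M_eq[OF cl] d[OF v] d'[OF v] by simp
    have "[\<kappa> (M (f xs) (g xs) (g' xs)) - \<kappa> (f' xs) = (\<kappa> (f xs) - \<kappa> (g xs) + \<kappa> (g' xs)) - \<kappa> (f' xs)] (mod l)"
      using \<kappa>_M[OF cl] d[OF v] by (intro cong_diff) auto
    moreover have "[(\<kappa> (f xs) - \<kappa> (g xs)) - (\<kappa> (f' xs) - \<kappa> (g' xs)) = d v - d' v] (mod l)"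
      using d[OF v] d'[OF v] by (intro cong_diff) auto
    ultimately show "[\<kappa> (M (f xs) (g xs) (g' xs)) - \<kappa> (f' xs) = d v - d' v] (mod l)"
      by (smt (verit, best) cong_trans)
  qed
  ultimately show "(\<lambda>v. d v - d' v) \<in> differences k"
    unfolding differences_def using ops(3) by blast
next
  fix d k n and w :: "nat \<Rightarrow> (nat \<Rightarrow> int) \<Rightarrow> int"
  assume "d \<in> differences k" and n: "0 < n" and w: "\<And>i. i < k \<Longrightarrow> aff n (w i)"
  then obtain f g where ops: "term_op A k f" "term_op A k g"
    and d: "\<And>v xs. lies_over k v xs \<Longrightarrow> \<chi> (f xs) = \<chi> (g xs) \<and> [\<kappa> (f xs) - \<kappa> (g xs) = d v] (mod l)"
    unfolding differences_def by blast
  have "\<forall>i. \<exists>W. i < k \<longrightarrow> term_op A n W \<and> (\<forall>v xs. lies_over n v xs \<longrightarrow> [w i v = \<chi> (W xs)] (mod q))"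
    using aff_realized[OF w] by blast
  then obtain W where W: "\<And>i. i < k \<Longrightarrow> term_op A n (W i)"
    "\<And>i v xs. i < k \<Longrightarrow> lies_over n v xs \<Longrightarrow> [w i v = \<chi> (W i xs)] (mod q)" by metis
  have over: "lies_over k (\<lambda>i. w i v) (map (\<lambda>i. W i xs) [0..<k])" if "lies_over n v xs" for v xs
    using that W term_op_closed[OF ualg W(1)] by (auto simp: lies_over_def)
  have "term_op A n (\<lambda>xs. f (map (\<lambda>i. W i xs) [0..<k]))" "term_op A n (\<lambda>xs. g (map (\<lambda>i. W i xs) [0..<k]))"
    by (rule term_op_comp[OF ualg ops(1) n W(1)], assumption) (rule term_op_comp[OF ualg ops(2) n W(1)])
  then show "(\<lambda>v. d (\<lambda>i. w i v)) \<in> differences n"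
    unfolding differences_def using d[OF over] by blast
next
  fix d d' k assume "d \<in> differences k" "\<And>v. [d v = d' v] (mod l)"
  then show "d' \<in> differences k" unfolding differences_def by (blast intro: cong_trans)
next
  fix d k and v v' :: "nat \<Rightarrow> int"
  assume d: "d \<in> differences k" and v: "\<And>i. i < k \<Longrightarrow> [v i = v' i] (mod q)"
  obtain xs where xs: "lies_over k v xs" using ex_lies_over[OF q] by blast
  then have "lies_over k v' xs" using v unfolding lies_over_def by (meson cong_sym cong_trans)
  with xs d show "[d v = d v'] (mod l)"
    unfolding differences_def by (blast intro: cong_trans cong_sym)
qed

end

text \<open>
  Given \<open>f\<close> in the larger clone, an operation \<open>g\<close> of the same linear type is built in the smaller clone from binary minors of \<open>f\<close>. The
  difference \<open>d\<close> of \<open>f\<close> and \<open>g\<close> is also the difference of two operations \<open>f'\<close> and \<open>g'\<close> of the smaller clone,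
  because the two clonoids have the same binary members. Then \<open>f = M f' g' g\<close>.
\<close>
theorem generated_by_ternary_operations:
  fixes A :: "('s, 'a) ualg" and B :: "('t, 'a) ualg" and q l :: int
  assumes A: "coordinatized_algebra A M q l \<chi> \<kappa>" and B: "is_ualg B" "carrier B = carrier A"
    and sub: "\<And>k f. term_op B k f \<Longrightarrow> term_op A k f" and ternary: "\<And>f. term_op A 3 f \<Longrightarrow> term_op B 3 f"
    and q: "squarefree q" "coprime q l" "q > 0"
    and f: "term_op A k f"
  shows "term_op B k f"
proof -
  interpret A: coordinatized_algebra A M q l \<chi> \<kappa> by fact
  interpret B: coordinatized_algebra B M q l \<chi> \<kappa>
  proof
    show "is_ualg B" by fact
    show "term_op B 3 (\<lambda>xs. M (xs ! 0) (xs ! 1) (xs ! 2))" by (rule ternary[OF A.M_op])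
    fix k f and x y z :: "nat \<Rightarrow> 'a"
    assume f: "term_op B k f" and X: "\<And>i. i < k \<Longrightarrow> x i \<in> carrier B" "\<And>i. i < k \<Longrightarrow> y i \<in> carrier B"
    show "\<chi> (f (map x [0..<k])) = \<chi> (f (map y [0..<k]))" if "\<And>i. i < k \<Longrightarrow> \<chi> (x i) = \<chi> (y i)"
      using X that unfolding B(2) by (intro A.\<chi>_cong[OF sub[OF f]])
    assume z: "\<And>i. i < k \<Longrightarrow> z i \<in> carrier B"
    show "\<chi> (f (map (\<lambda>i. M (x i) (y i) (z i)) [0..<k])) =
        \<chi> (M (f (map x [0..<k])) (f (map y [0..<k])) (f (map z [0..<k])))"
      using X z unfolding B(2) by (intro A.\<chi>_affine[OF sub[OF f]])
    show "f (map (\<lambda>i. M (x i) (y i) (z i)) [0..<k]) =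
        M (f (map x [0..<k])) (f (map y [0..<k])) (f (map z [0..<k]))" if "\<And>i. i < k \<Longrightarrow> \<chi> (x i) = \<chi> (y i)"
      using X z that unfolding B(2) by (intro A.central[OF sub[OF f]])
  qed (use A.malcev_right A.malcev_left A.\<chi>_range A.\<kappa>_range A.\<chi>_surj A.coordinates_inj A.\<chi>_M A.\<kappa>_M in \<open>simp_all add: B(2)\<close>)
  have k: "0 < k" using term_op_arity_pos[OF A.ualg f] .
  have upt2: "[0..<2] = [0, 1 :: nat]" by (simp add: upt_rec)
  have binary: "term_op B 2 h" if h: "term_op A 2 h" for h
  proof -
    have "term_op A 3 (\<lambda>xs. h (map (\<lambda>i. xs ! i) [0..<2]))"
      by (rule term_op_comp[OF A.ualg h]) (auto intro: term_op_proj)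
    then have "term_op B 3 (\<lambda>xs. h (map (\<lambda>i. xs ! i) [0..<2]))" by (rule ternary)
    then have "term_op B 2 (\<lambda>xs. h (map (\<lambda>i. map (\<lambda>i. xs ! min i 1) [0..<3] ! i) [0..<2]))"
      by (rule term_op_comp[OF B.ualg, of _ _ 2 "\<lambda>i xs. xs ! min i 1"]) (auto intro: term_op_proj)
    then show ?thesis
      by (rule term_op_cong) (auto simp: tuples_def upt_rec numeral_2_eq_2 length_Suc_conv)
  qed
  have over: "B.lies_over = A.lies_over"
    by (simp add: fun_eq_iff A.lies_over_def B.lies_over_def B(2))
  have "A.differences 2 \<subseteq> B.differences 2"
    unfolding A.differences_def B.differences_def over using binary by blast
  then have differences: "A.differences k \<subseteq> B.differences k"
    using clonoid_determined_by_binary[OF A.clonoid_differences B.clonoid_differences q] k q(3) by auto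
  \<comment> \<open>Truncations \<open>t\<close> of a tuple, and tuples \<open>e\<close> with one free entry: \<open>t (i + 1) = M (t i) (e 0) (e i)\<close>, where \<open>e 0\<close> is constant.\<close>
  define t where "t i xs = (\<lambda>j. if j < i then xs ! j else xs ! 0 :: 'a)" for i xs
  define e where "e i xs = (\<lambda>j. if j = i then xs ! i else xs ! 0 :: 'a)" for i xs
  let ?f = "\<lambda>x. f (map x [0..<k])"
  let ?X = "carrier A"
  have tX: "t i xs j \<in> ?X" and eX: "i < k \<Longrightarrow> e i xs j \<in> ?X" if "xs \<in> tuples ?X k" "j < k" for i xs j
    using that k by (auto simp: t_def e_def tuples_nth)
  have fe: "term_op B k (\<lambda>xs. ?f (e i xs))" if i: "i < k" for i
  proof -
    have "term_op A 2 (\<lambda>ys. f (map (\<lambda>j. ys ! (if j = i then 1 else 0)) [0..<k]))"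
      by (rule term_op_comp[OF A.ualg f]) (auto intro: term_op_proj)
    then have "term_op B k (\<lambda>xs. f (map (\<lambda>j. map (\<lambda>m. xs ! (if m = 1 then i else 0)) [0..<2] ! (if j = i then 1 else 0)) [0..<k]))"
      by (rule term_op_comp[OF B.ualg binary k, of _ "\<lambda>m xs. xs ! (if m = 1 then i else 0)"])
        (use i k in \<open>auto intro!: term_op_proj\<close>)
    then show ?thesis
      by (rule term_op_cong) (auto simp: e_def upt2 intro!: arg_cong[where f = f])
  qed
  have "\<exists>g. term_op B k g \<and> (\<forall>xs\<in>tuples ?X k. \<chi> (?f (t i xs)) = \<chi> (g xs)) \<and>
      (\<forall>xs\<in>tuples ?X k. \<forall>xs'\<in>tuples ?X k. (\<forall>j<k. \<chi> (xs ! j) = \<chi> (xs' ! j)) \<longrightarrow>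
        [\<kappa> (?f (t i xs)) - \<kappa> (g xs) = \<kappa> (?f (t i xs')) - \<kappa> (g xs')] (mod l))" if "i \<le> k" for i
    using that
  proof (induction i)
    case 0
    have "t 0 xs = e 0 xs" for xs by (auto simp: t_def e_def)
    then show ?case using fe[OF k] by (intro exI[of _ "\<lambda>xs. ?f (e 0 xs)"]) auto
  next
    case (Suc i)
    then have i: "i < k" by simp
    from Suc obtain g where g: "term_op B k g" "\<And>xs. xs \<in> tuples ?X k \<Longrightarrow> \<chi> (?f (t i xs)) = \<chi> (g xs)"
      and g_diff: "\<And>xs xs'. xs \<in> tuples ?X k \<Longrightarrow> xs' \<in> tuples ?X k \<Longrightarrow> (\<forall>j<k. \<chi> (xs ! j) = \<chi> (xs' ! j)) \<Longrightarrow>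
        [\<kappa> (?f (t i xs)) - \<kappa> (g xs) = \<kappa> (?f (t i xs')) - \<kappa> (g xs')] (mod l)" by (metis Suc_leD)
    define g' where "g' xs = M (g xs) (?f (e 0 xs)) (?f (e i xs))" for xs
    have cl: "?f (t i xs) \<in> ?X" "?f (e 0 xs) \<in> ?X" "?f (e i xs) \<in> ?X" "g xs \<in> ?X" if xs: "xs \<in> tuples ?X k" for xs
      using tX[OF xs] eX[OF xs] i k term_op_closed[OF A.ualg sub[OF g(1)] xs] by (auto intro!: A.closed[OF f])
    have tS: "?f (t (Suc i) xs) = ?f (\<lambda>j. M (t i xs j) (e 0 xs j) (e i xs j))" if "xs \<in> tuples ?X k" for xs
      using tuples_nth[OF that] i k
      by (intro arg_cong[where f = f] map_cong refl) (auto simp: t_def e_def A.malcev_left A.malcev_right less_Suc_eq)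
    have "term_op B k g'" unfolding g'_def by (intro B.term_op_M g fe i k)
    moreover have "\<chi> (?f (t (Suc i) xs)) = \<chi> (g' xs)" if xs: "xs \<in> tuples ?X k" for xs
    proof -
      have "\<chi> (?f (t (Suc i) xs)) = \<chi> (M (?f (t i xs)) (?f (e 0 xs)) (?f (e i xs)))"
        unfolding tS[OF xs] by (rule A.\<chi>_affine[OF f]) (use tX[OF xs] eX[OF xs] i k in auto)
      also have "\<dots> = \<chi> (g' xs)"
        unfolding g'_def by (rule A.\<chi>_M_cong) (use cl[OF xs] g(2)[OF xs] in auto)
      finally show ?thesis .
    qed
    moreover have "[\<kappa> (?f (t (Suc i) xs)) - \<kappa> (g' xs) = \<kappa> (?f (t (Suc i) xs')) - \<kappa> (g' xs')] (mod l)"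
      if xs: "xs \<in> tuples ?X k" "xs' \<in> tuples ?X k" and eq: "\<forall>j<k. \<chi> (xs ! j) = \<chi> (xs' ! j)" for xs xs'
    proof -
      have te: "\<chi> (t m xs j) = \<chi> (t m xs' j)" "m < k \<Longrightarrow> \<chi> (e m xs j) = \<chi> (e m xs' j)" if "j < k" for m j
        using eq that k by (auto simp: t_def e_def)
      have fte: "\<chi> (?f (t i xs)) = \<chi> (?f (t i xs'))" "\<And>m. m < k \<Longrightarrow> \<chi> (?f (e m xs)) = \<chi> (?f (e m xs'))"
        using tX[OF xs(1)] tX[OF xs(2)] eX[OF xs(1)] eX[OF xs(2)] te by (auto intro!: A.\<chi>_cong[OF f])
      have 1: "[\<kappa> (?f (t (Suc i) xs)) - \<kappa> (?f (t (Suc i) xs')) =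
          (\<kappa> (?f (t i xs)) - \<kappa> (?f (t i xs'))) - (\<kappa> (?f (e 0 xs)) - \<kappa> (?f (e 0 xs')))
          + (\<kappa> (?f (e i xs)) - \<kappa> (?f (e i xs')))] (mod l)"
        unfolding tS[OF xs(1)] tS[OF xs(2)]
        by (rule A.\<kappa>_op_diff[OF f]) (use tX[OF xs(1)] tX[OF xs(2)] eX[OF xs(1)] eX[OF xs(2)] te i k in auto)
      have 2: "[\<kappa> (g' xs) - \<kappa> (g' xs') =
          (\<kappa> (g xs) - \<kappa> (g xs')) - (\<kappa> (?f (e 0 xs)) - \<kappa> (?f (e 0 xs')))
          + (\<kappa> (?f (e i xs)) - \<kappa> (?f (e i xs')))] (mod l)"
        unfolding g'_def
        by (rule A.\<kappa>_M_diff) (use cl[OF xs(1)] cl[OF xs(2)] fte i k g(2)[OF xs(1)] g(2)[OF xs(2)] in auto)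
      show ?thesis
        using dvd_add[OF dvd_diff[OF 1[unfolded cong_iff_dvd_diff] 2[unfolded cong_iff_dvd_diff]]
            g_diff[OF xs eq, unfolded cong_iff_dvd_diff]]
        by (simp add: cong_iff_dvd_diff algebra_simps)
    qed
    ultimately show ?case by blast
  qed
  from this[of k] obtain g where g: "term_op B k g" "\<And>xs. xs \<in> tuples ?X k \<Longrightarrow> \<chi> (?f (t k xs)) = \<chi> (g xs)"
    and g_diff: "\<And>xs xs'. xs \<in> tuples ?X k \<Longrightarrow> xs' \<in> tuples ?X k \<Longrightarrow> (\<forall>j<k. \<chi> (xs ! j) = \<chi> (xs' ! j)) \<Longrightarrow>
      [\<kappa> (?f (t k xs)) - \<kappa> (g xs) = \<kappa> (?f (t k xs')) - \<kappa> (g xs')] (mod l)" by blast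
  have tk: "?f (t k xs) = f xs" if "xs \<in> tuples ?X k" for xs
  proof -
    have "map (t k xs) [0..<k] = map (\<lambda>i. xs ! i) [0..<k]" by (auto simp: t_def)
    then show ?thesis using tuples_map_nth[OF that] by simp
  qed
  define lift where "lift v = (SOME xs. A.lies_over k v xs)" for v
  have lift: "A.lies_over k v (lift v)" for v
    unfolding lift_def using A.ex_lies_over[OF q(3)] by (rule someI_ex)
  define d where "d v = \<kappa> (f (lift v)) - \<kappa> (g (lift v))" for v
  have d: "\<chi> (f xs) = \<chi> (g xs)" "[\<kappa> (f xs) - \<kappa> (g xs) = d v] (mod l)" if v: "A.lies_over k v xs" for v xs
  proof -
    have xs: "xs \<in> tuples ?X k" "lift v \<in> tuples ?X k" using v lift by (auto simp: A.lies_over_def)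
    have "\<chi> (xs ! j) = \<chi> (lift v ! j)" if "j < k" for j
      using v lift[of v] that xs
      by (intro A.\<chi>_eqI tuples_nth[OF _ that]) (auto simp: A.lies_over_def cong_def)
    then show "[\<kappa> (f xs) - \<kappa> (g xs) = d v] (mod l)"
      using g_diff[OF xs] tk[OF xs(1)] tk[OF xs(2)] by (simp add: d_def)
    show "\<chi> (f xs) = \<chi> (g xs)" using g(2)[OF xs(1)] tk[OF xs(1)] by simp
  qed
  have "d \<in> A.differences k"
    unfolding A.differences_def using f sub[OF g(1)] d by blast
  then have "d \<in> B.differences k" using differences by blast
  then obtain f' g' where ops: "term_op B k f'" "term_op B k g'"
    and d': "\<And>v xs. A.lies_over k v xs \<Longrightarrow> \<chi> (f' xs) = \<chi> (g' xs) \<and> [\<kappa> (f' xs) - \<kappa> (g' xs) = d v] (mod l)"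
    unfolding B.differences_def over by blast
  have "term_op B k (\<lambda>xs. M (f' xs) (g' xs) (g xs))" by (intro B.term_op_M ops g)
  then show ?thesis
  proof (rule term_op_cong)
    fix xs assume "xs \<in> tuples (carrier B) k"
    then have xs: "xs \<in> tuples ?X k" by (simp add: B(2))
    define v where "v j = \<chi> (xs ! j)" for j
    have v: "A.lies_over k v xs" using xs by (simp add: A.lies_over_def v_def)
    have cl: "f xs \<in> ?X" "f' xs \<in> ?X" "g' xs \<in> ?X" "g xs \<in> ?X"
      using xs term_op_closed[OF A.ualg] f ops g(1) sub by blast+
    have "\<chi> (M (f' xs) (g' xs) (g xs)) = \<chi> (f xs)"
      using A.\<chi>_M_eq[OF cl(2-4)] d'[OF v] d(1)[OF v] by simp
    moreover have "[\<kappa> (M (f' xs) (g' xs) (g xs)) = \<kappa> (f xs)] (mod l)"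
    proof -
      have 1: "[\<kappa> (M (f' xs) (g' xs) (g xs)) = \<kappa> (f' xs) - \<kappa> (g' xs) + \<kappa> (g xs)] (mod l)"
        using A.\<kappa>_M[OF cl(2-4)] d'[OF v] by simp
      have 2: "[\<kappa> (f' xs) - \<kappa> (g' xs) + \<kappa> (g xs) = d v + \<kappa> (g xs)] (mod l)"
        using d'[OF v] by (intro cong_add) auto
      have "[\<kappa> (f xs) - \<kappa> (g xs) + \<kappa> (g xs) = d v + \<kappa> (g xs)] (mod l)"
        using d(2)[OF v] by (intro cong_add) auto
      then have 3: "[d v + \<kappa> (g xs) = \<kappa> (f xs)] (mod l)" by (simp add: cong_sym)
      show ?thesis by (rule cong_trans[OF 1 cong_trans[OF 2 3]])
    qed
    ultimately show "M (f' xs) (g' xs) (g xs) = f xs"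
      using cl by (intro A.coordinates_inj A.\<kappa>_eqI A.M_closed)
  qed
qed

section \<open>Finiteness for squarefree orders\<close>

lemma commutator_least: "congruence A \<delta> \<Longrightarrow> centralizes A \<alpha> \<beta> \<delta> \<Longrightarrow> commutator A \<alpha> \<beta> \<subseteq> \<delta>"
  unfolding commutator_def by blast

lemma centralizes_commutator: "centralizes A \<alpha> \<beta> (commutator A \<alpha> \<beta>)"
  unfolding commutator_def centralizes_def by blast

lemma congruence_one_cong:
  assumes "is_ualg A" shows "congruence A (one_cong A)"
  unfolding congruence_def one_cong_def
proof (intro conjI ballI allI impI)
  show "equiv (carrier A) (carrier A \<times> carrier A)"
    by (auto simp: equiv_def refl_on_def sym_def trans_def)
  fix s xs ys assume s: "s \<in> symbols A"
    and *: "length xs = arity A s \<and> list_all2 (\<lambda>x y. (x, y) \<in> carrier A \<times> carrier A) xs ys"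
  have "xs \<in> tuples (carrier A) (arity A s)" "ys \<in> tuples (carrier A) (arity A s)"
    using list_all2_in_tuples[OF subset_refl] * by blast+
  then show "(interp A s xs, interp A s ys) \<in> carrier A \<times> carrier A"
    using assms s by (auto simp: is_ualg_def Pi_def)
qed

lemma centralizes_one_cong:
  assumes A: "is_ualg A" and "\<alpha> \<subseteq> carrier A \<times> carrier A" "\<beta> \<subseteq> carrier A \<times> carrier A"
  shows "centralizes A \<alpha> \<beta> (one_cong A)"
  unfolding centralizes_def one_cong_def
proof (intro allI impI)
  fix t as bs cs ds
  assume t: "(length as + length cs, t) \<in> clone A"
    and l: "list_all2 (\<lambda>a b. (a, b) \<in> \<alpha>) as bs" "list_all2 (\<lambda>c d. (c, d) \<in> \<beta>) cs ds"
  have "bs \<in> tuples (carrier A) (length as)" "cs \<in> tuples (carrier A) (length cs)" "ds \<in> tuples (carrier A) (length cs)"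
    using list_all2_in_tuples[OF assms(2) refl l(1)] list_all2_in_tuples[OF assms(3) refl l(2)] by auto
  then have "bs @ cs \<in> tuples (carrier A) (length as + length cs)" "bs @ ds \<in> tuples (carrier A) (length as + length cs)"
    by (auto simp: tuples_def)
  then show "(t (bs @ cs), t (bs @ ds)) \<in> carrier A \<times> carrier A"
    using clone_closed[OF A t] by blast
qed

text \<open>
  The family of congruences that is intersected contains the full congruence, so the intersection is not vacuous.
\<close>
lemma congruence_commutator:
  assumes A: "is_ualg A" and "\<alpha> \<subseteq> carrier A \<times> carrier A" "\<beta> \<subseteq> carrier A \<times> carrier A"
  shows "congruence A (commutator A \<alpha> \<beta>)"
proof -
  let ?F = "{\<delta>. congruence A \<delta> \<and> centralizes A \<alpha> \<beta> \<delta>}"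
  have one: "one_cong A \<in> ?F" using congruence_one_cong[OF A] centralizes_one_cong[OF assms] by simp
  have eqv: "equiv (carrier A) \<delta>" if "\<delta> \<in> ?F" for \<delta> using that by (simp add: congruence_def)
  have "equiv (carrier A) (\<Inter> ?F)"
  proof (rule equivI)
    show "\<Inter> ?F \<subseteq> carrier A \<times> carrier A" using one by (auto simp: one_cong_def)
    show "refl_on (carrier A) (\<Inter> ?F)" using eqv unfolding equiv_def refl_on_def by blast
    show "sym (\<Inter> ?F)" using eqv unfolding equiv_def sym_def by blast
    show "trans (\<Inter> ?F)" using eqv unfolding equiv_def trans_def by blast
  qed
  moreover have "(interp A s xs, interp A s ys) \<in> \<Inter> ?F"
    if "s \<in> symbols A" "length xs = arity A s" "list_all2 (\<lambda>x y. (x, y) \<in> \<Inter> ?F) xs ys" for s xs ys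
  proof
    fix \<delta> assume \<delta>: "\<delta> \<in> ?F"
    then have "list_all2 (\<lambda>x y. (x, y) \<in> \<delta>) xs ys" using that(3) by (auto elim: list.rel_mono_strong)
    then show "(interp A s xs, interp A s ys) \<in> \<delta>" using \<delta> that by (simp add: congruence_def)
  qed
  ultimately show ?thesis unfolding commutator_def congruence_def by blast
qed

lemma two_nilpotent_malcev_central_extension:
  assumes A: "is_ualg A" "malcev A" "two_nilpotent A"
  obtains M where "central_extension A M (commutator A (one_cong A) (one_cong A))"
proof -
  let ?one = "one_cong A"
  let ?\<theta> = "commutator A ?one ?one"
  obtain m where m: "(3, m) \<in> clone A"
    "\<And>x y. x \<in> carrier A \<Longrightarrow> y \<in> carrier A \<Longrightarrow> m [x, y, y] = x \<and> m [y, y, x] = x"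
    using A(2) unfolding malcev_def by blast
  have m_op: "term_op A 3 (\<lambda>xs. m [xs ! 0, xs ! 1, xs ! 2])"
  proof (rule term_op_cong)
    show "term_op A 3 m" using m(1) by (simp add: clone_iff_term_op)
  qed (auto simp: tuples_def numeral_3_eq_3 length_Suc_conv)
  have one: "?one \<subseteq> carrier A \<times> carrier A" by (simp add: one_cong_def)
  have \<theta>: "congruence A ?\<theta>" by (rule congruence_commutator[OF A(1) one one])
  then have \<theta>_sub: "?\<theta> \<subseteq> carrier A \<times> carrier A" by (auto simp: congruence_def equiv_def refl_on_def)
  have zero: "commutator A ?one ?\<theta> = zero_cong A" using A(3) by (simp add: two_nilpotent_def)
  have "central_extension A (\<lambda>x y z. m [x, y, z]) ?\<theta>"
  proof
    fix k f and x y z :: "nat \<Rightarrow> 'b"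
    assume f: "term_op A k f" and z: "\<And>i. i < k \<Longrightarrow> z i \<in> carrier A"
    show "(f (map (\<lambda>i. m [x i, y i, z i]) [0..<k]), m [f (map x [0..<k]), f (map y [0..<k]), f (map z [0..<k])]) \<in> ?\<theta>"
      if "\<And>i. i < k \<Longrightarrow> x i \<in> carrier A" "\<And>i. i < k \<Longrightarrow> y i \<in> carrier A"
      by (rule malcev_commutes_mod_commutator[OF A(1) m_op _ _ congruence_one_cong[OF A(1)] \<theta> centralizes_commutator f])
        (use m(2) that z in \<open>auto simp: one_cong_def\<close>)
    show "f (map (\<lambda>i. m [x i, y i, z i]) [0..<k]) = m [f (map x [0..<k]), f (map y [0..<k]), f (map z [0..<k])]"
      if "\<And>i. i < k \<Longrightarrow> (x i, y i) \<in> ?\<theta>"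
    proof -
      have "(f (map (\<lambda>i. m [x i, y i, z i]) [0..<k]), m [f (map x [0..<k]), f (map y [0..<k]), f (map z [0..<k])])
          \<in> commutator A ?one ?\<theta>"
        by (rule malcev_commutes_mod_commutator[OF A(1) m_op _ _ \<theta> congruence_commutator[OF A(1) one \<theta>_sub]
              centralizes_commutator f]) (use m(2) that z in auto)
      then show ?thesis by (auto simp: zero zero_cong_def)
    qed
  qed (use A(1) m_op m(2) \<theta> in auto)
  then show thesis by (rule that)
qed

lemma squarefree_mult_imp_coprime: "squarefree (a * b) \<Longrightarrow> coprime a (b :: nat)"
  by (metis coprimeI mult_dvd_mono power2_eq_square squarefreeD)

lemma squarefree_int: "squarefree n \<Longrightarrow> squarefree (int n)"
proof (rule squarefreeI)
  fix x assume "squarefree n" "x ^ 2 dvd int n"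
  then have "nat \<bar>x\<bar> ^ 2 dvd n"
    by (metis abs_ge_zero int_nat_eq of_nat_dvd_iff of_nat_power power2_abs)
  with \<open>squarefree n\<close> have "nat \<bar>x\<bar> dvd 1" by (rule squarefreeD)
  then show "x dvd 1" by auto
qed

definition ternary_algebra :: "'a set \<Rightarrow> ('a list \<Rightarrow> 'a) set \<Rightarrow> ('a list \<Rightarrow> 'a, 'a) ualg" where
  "ternary_algebra X T = \<lparr>carrier = X, symbols = T, arity = (\<lambda>_. 3), interp = (\<lambda>f. f)\<rparr>"

text \<open>
  The comparison algebra depends only on the ternary operations, so that two clones with the
  same ternary operations are equal.
\<close>
theorem clone_determined_by_ternary_operations:
  fixes A :: "('s, 'a) ualg"
  assumes A: "is_ualg A" "malcev A" "two_nilpotent A"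
    and fin: "finite (carrier A)" and sf: "squarefree (card (carrier A))"
  shows "clone A = clone (ternary_algebra (carrier A) {f. (3, f) \<in> clone A})"
proof -
  let ?X = "carrier A"
  define B where "B = ternary_algebra ?X {f. (3, f) \<in> clone A}"
  have B: "is_ualg B" "carrier B = ?X"
    using A(1) clone_closed[OF A(1)] by (auto simp: B_def ternary_algebra_def is_ualg_def)
  have sub: "(k, f) \<in> clone A" if "(k, f) \<in> clone B" for k f
    using that
  proof induction
    case (proj i k)
    then show ?case unfolding B(2) by (rule clone.proj)
  next
    case (basic s)
    then have "(3, s) \<in> clone A" by (simp add: B_def ternary_algebra_def)
    then show ?case using clone_extensional by (fastforce simp: B_def ternary_algebra_def extensional_restrict)
  next
    case (comp gs f k)
    then show ?case unfolding B(2) by (intro clone.comp)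
  qed
  have ternary: "term_op B 3 f" if "term_op A 3 f" for f
  proof -
    have "restrict f (tuples ?X 3) \<in> symbols B" using that by (simp add: term_op_def B_def ternary_algebra_def)
    from clone.basic[OF this] show ?thesis by (simp add: term_op_def B_def ternary_algebra_def)
  qed
  obtain M where "central_extension A M (commutator A (one_cong A) (one_cong A))"
    using two_nilpotent_malcev_central_extension[OF A] .
  then interpret ce: central_extension A M "commutator A (one_cong A) (one_cong A)" .
  obtain q l \<chi> \<kappa> where ql: "q * l = card ?X"
    and \<chi>: "\<And>x. x \<in> ?X \<Longrightarrow> \<chi> x \<in> {0..<int q}" and \<kappa>: "\<And>x. x \<in> ?X \<Longrightarrow> \<kappa> x \<in> {0..<int l}"
    and surj: "\<And>a b. a \<in> {0..<int q} \<Longrightarrow> b \<in> {0..<int l} \<Longrightarrow> \<exists>x\<in>?X. \<chi> x = a \<and> \<kappa> x = b"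
    and inj: "\<And>x y. x \<in> ?X \<Longrightarrow> y \<in> ?X \<Longrightarrow> \<chi> x = \<chi> y \<Longrightarrow> \<kappa> x = \<kappa> y \<Longrightarrow> x = y"
    and \<chi>_iff: "\<And>x y. x \<in> ?X \<Longrightarrow> y \<in> ?X \<Longrightarrow> (x, y) \<in> commutator A (one_cong A) (one_cong A) \<longleftrightarrow> \<chi> x = \<chi> y"
    and \<chi>M: "\<And>x y z. x \<in> ?X \<Longrightarrow> y \<in> ?X \<Longrightarrow> z \<in> ?X \<Longrightarrow> [\<chi> (M x y z) = \<chi> x - \<chi> y + \<chi> z] (mod int q)"
    and \<kappa>M: "\<And>x y z. x \<in> ?X \<Longrightarrow> y \<in> ?X \<Longrightarrow> z \<in> ?X \<Longrightarrow> \<chi> x = \<chi> y \<Longrightarrow>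
      [\<kappa> (M x y z) = \<kappa> x - \<kappa> y + \<kappa> z] (mod int l)"
    using ce.exists_coordinates[OF fin sf] by blast
  have "card ?X > 0" using A(1) fin by (auto simp: is_ualg_def card_gt_0_iff)
  then have pos: "q > 0" "l > 0" using ql by (auto intro: Nat.gr0I)
  have "coordinatized_algebra A M (int q) (int l) \<chi> \<kappa>"
  proof
    show "\<exists>x\<in>?X. \<chi> x = a" if "a \<in> {0..<int q}" for a
      using surj[OF that, of 0] pos by auto
    fix k f and x y z :: "nat \<Rightarrow> 'a"
    assume f: "term_op A k f" and X: "\<And>i. i < k \<Longrightarrow> x i \<in> ?X" "\<And>i. i < k \<Longrightarrow> y i \<in> ?X"
    have cl: "f (map w [0..<k]) \<in> ?X" if "\<And>i. i < k \<Longrightarrow> w i \<in> ?X" for w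
      by (rule term_op_closed[OF A(1) f]) (use that in \<open>auto intro: map_upt_in_tuples\<close>)
    show "\<chi> (f (map x [0..<k])) = \<chi> (f (map y [0..<k]))" if "\<And>i. i < k \<Longrightarrow> \<chi> (x i) = \<chi> (y i)"
    proof -
      have "(restrict f (tuples ?X k) (map x [0..<k]), restrict f (tuples ?X k) (map y [0..<k]))
          \<in> commutator A (one_cong A) (one_cong A)"
        by (rule congruence_clone[OF A(1) ce.cong f[unfolded term_op_def]])
          (use X that \<chi>_iff in \<open>auto simp: list_all2_map1 list_all2_map2 list_all2_same\<close>)
      then show ?thesis using X cl \<chi>_iff by (simp add: map_upt_in_tuples)
    qed
    assume z: "\<And>i. i < k \<Longrightarrow> z i \<in> ?X"
    show "\<chi> (f (map (\<lambda>i. M (x i) (y i) (z i)) [0..<k])) =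
        \<chi> (M (f (map x [0..<k])) (f (map y [0..<k])) (f (map z [0..<k])))"
      using ce.affine[OF f X z] X z cl \<chi>_iff ce.M_closed by simp
    show "f (map (\<lambda>i. M (x i) (y i) (z i)) [0..<k]) =
        M (f (map x [0..<k])) (f (map y [0..<k])) (f (map z [0..<k]))" if "\<And>i. i < k \<Longrightarrow> \<chi> (x i) = \<chi> (y i)"
      using that X z \<chi>_iff by (intro ce.central[OF f]) auto
  qed (use A(1) ce.M_op ce.malcev_left ce.malcev_right \<chi> \<kappa> inj \<chi>M \<kappa>M in auto)
  moreover have "squarefree (int q)" using sf ql squarefree_multD(1) squarefree_int by metis
  moreover have "coprime (int q) (int l)" using sf ql squarefree_mult_imp_coprime by (metis coprime_int_iff)
  ultimately have "term_op B k f" if "term_op A k f" for k f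
    using generated_by_ternary_operations[OF _ B _ ternary _ _ _ that] sub pos
    by (auto simp: term_op_def B(2))
  then have "(k, f) \<in> clone B" if "(k, f) \<in> clone A" for k f
    using that by (simp add: clone_iff_term_op B(2))
  with sub show ?thesis unfolding B_def[symmetric] by auto
qed

theorem finite_term_equivalence_classes:
  assumes fin: "finite X" and sf: "squarefree (card X)"
  shows "finite (term_equivalence_classes (two_nilpotent_malcev_algebras X :: ('s, 'a) ualg set))"
proof -
  define K :: "('s, 'a) ualg set" where "K = two_nilpotent_malcev_algebras X"
  define T where "T A = {f. (3, f) \<in> clone A}" for A :: "('s, 'a) ualg"
  have clone_eq: "clone A = clone (ternary_algebra X (T A))" if "A \<in> K" for A
    using clone_determined_by_ternary_operations[of A] that fin sf
    by (auto simp: K_def two_nilpotent_malcev_algebras_def T_def)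
  have iff: "term_equivalent A B \<longleftrightarrow> T B = T A" if "A \<in> K" "B \<in> K" for A B
  proof
    show "T B = T A" if "term_equivalent A B" using that by (simp add: term_equivalent_def T_def)
    show "term_equivalent A B" if "T B = T A"
      using clone_eq[OF \<open>A \<in> K\<close>] clone_eq[OF \<open>B \<in> K\<close>] that \<open>A \<in> K\<close> \<open>B \<in> K\<close>
      by (auto simp: term_equivalent_def K_def two_nilpotent_malcev_algebras_def)
  qed
  have T_sub: "T A \<subseteq> tuples X 3 \<rightarrow>\<^sub>E X" if "A \<in> K" for A
  proof
    fix f assume "f \<in> T A"
    then have f: "(3, f) \<in> clone A" by (simp add: T_def)
    have "is_ualg A" "carrier A = X" using that by (auto simp: K_def two_nilpotent_malcev_algebras_def)
    then show "f \<in> tuples X 3 \<rightarrow>\<^sub>E X" using clone_closed[OF _ f] clone_extensional[OF f] by (auto simp: PiE_def)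
  qed
  have "term_equivalence_classes K \<subseteq> (\<lambda>S. {B \<in> K. T B = S}) ` Pow (tuples X 3 \<rightarrow>\<^sub>E X)"
  proof
    fix c assume "c \<in> term_equivalence_classes K"
    then obtain A where A: "A \<in> K" "c = {(A, B). A \<in> K \<and> B \<in> K \<and> term_equivalent A B} `` {A}"
      unfolding term_equivalence_classes_def by (rule quotientE)
    then have "c = {B \<in> K. T B = T A}" using iff by auto
    then show "c \<in> (\<lambda>S. {B \<in> K. T B = S}) ` Pow (tuples X 3 \<rightarrow>\<^sub>E X)" using T_sub[OF A(1)] by auto
  qed
  moreover have "finite (tuples X 3)" unfolding tuples_def by (rule finite_lists_length_eq[OF fin])
  then have "finite ((\<lambda>S. {B \<in> K. T B = S}) ` Pow (tuples X 3 \<rightarrow>\<^sub>E X))"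
    using fin by (simp add: finite_PiE)
  ultimately show ?thesis
    unfolding K_def[symmetric] by (rule finite_subset)
qed

section \<open>Infinitely many clones for orders with a square divisor\<close>

text \<open>
  The integer polynomial functions of degree at most \<open>d\<close>, in variables \<open>v 0, v 1, \<dots>\<close>.
\<close>
inductive poly_fun :: "nat \<Rightarrow> ((nat \<Rightarrow> int) \<Rightarrow> int) \<Rightarrow> bool" for d where
  monomial: "length I \<le> d \<Longrightarrow> poly_fun d (\<lambda>v. a * (\<Prod>i\<leftarrow>I. v i))"
| add: "poly_fun d P \<Longrightarrow> poly_fun d Q \<Longrightarrow> poly_fun d (\<lambda>v. P v + Q v)"

lemma poly_fun_zero: "poly_fun d (\<lambda>v. 0)"
  using poly_fun.monomial[of "[]" d 0] by simp

lemma poly_fun_sum: "(\<And>j. j \<in> J \<Longrightarrow> poly_fun d (P j)) \<Longrightarrow> poly_fun d (\<lambda>v. \<Sum>j\<in>J. P j v)"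
  by (induction J rule: infinite_finite_induct) (auto intro: poly_fun_zero poly_fun.add)

lemma poly_fun_mono: "poly_fun d P \<Longrightarrow> d \<le> d' \<Longrightarrow> poly_fun d' P"
  by (induction rule: poly_fun.induct) (auto intro: poly_fun.intros)

lemma poly_fun_times_linear:
  assumes "poly_fun d P" shows "poly_fun (Suc d) (\<lambda>v. (\<Sum>j<k. b j * v j) * P v)"
  using assms
proof induction
  case (monomial I a)
  have "poly_fun (Suc d) (\<lambda>v. \<Sum>j<k. (b j * a) * (\<Prod>i\<leftarrow>j # I. v i))"
    using monomial by (intro poly_fun_sum poly_fun.monomial) simp
  then show ?case by (simp add: sum_distrib_right sum_distrib_left mult_ac)
next
  case (add P Q)
  from poly_fun.add[OF add.IH] show ?case by (simp add: distrib_left)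
qed

lemma poly_fun_scale:
  assumes "poly_fun d P" shows "poly_fun d (\<lambda>v. b * P v)"
  using assms
proof induction
  case (monomial I a)
  then show ?case using poly_fun.monomial[of I d "b * a"] by (simp add: mult.assoc)
next
  case (add P Q)
  from poly_fun.add[OF add.IH] show ?case by (simp add: distrib_left)
qed

lemma poly_fun_linear_subst:
  assumes "poly_fun d P" shows "poly_fun d (\<lambda>v. P (\<lambda>i. \<Sum>j<k. b i j * v j))"
  using assms
proof induction
  case (monomial I a)
  have "poly_fun (length I) (\<lambda>v. \<Prod>i\<leftarrow>I. \<Sum>j<k. b i j * v j)"
  proof (induction I)
    case Nil
    show ?case using poly_fun.monomial[of "[]" 0 1] by simp
  next
    case (Cons i I)
    from poly_fun_times_linear[OF this, where k = k and b = "b i"] show ?case by simp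
  qed
  then show ?case using monomial poly_fun_mono poly_fun_scale by blast
next
  case (add P Q)
  from poly_fun.add[OF add.IH] show ?case by simp
qed

lemma poly_fun_cong:
  assumes "poly_fun d P" and "\<And>i. [v i = v' i] (mod m)" shows "[P v = P v'] (mod m)"
  using assms(1)
proof induction
  case (monomial I a)
  have "[(\<Prod>i\<leftarrow>I. v i) = (\<Prod>i\<leftarrow>I. v' i)] (mod m)"
    by (induction I) (auto intro: cong_mult assms(2))
  then show ?case by (intro cong_mult cong_refl)
next
  case (add P Q)
  then show ?case by (intro cong_add)
qed

definition vertex :: "nat set \<Rightarrow> nat \<Rightarrow> int" where
  "vertex S i = (if i \<in> S then 1 else 0)"

text \<open>
  A monomial of degree less than \<open>j\<close> misses one of the variables \<open>0, \<dots>, j - 1\<close>. Flipping that coordinate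
  preserves the monomial and changes the sign, so the terms cancel in pairs.
\<close>
lemma poly_fun_alternating_sum:
  assumes "poly_fun d P" "d < j"
  shows "(\<Sum>S\<in>Pow {..<j}. (- 1) ^ card S * P (vertex S)) = 0"
  using assms(1)
proof induction
  case (monomial I a)
  have "\<not> {..<j} \<subseteq> set I"
  proof
    assume "{..<j} \<subseteq> set I"
    then have "j \<le> card (set I)" using card_mono[of "set I" "{..<j}"] by simp
    then show False using card_length[of I] monomial \<open>d < j\<close> by linarith
  qed
  then obtain u where u: "u < j" "u \<notin> set I" by auto
  define h where "h S = (- 1) ^ card S * (a * (\<Prod>i\<leftarrow>I. vertex S i))" for S
  define flip where "flip S = (if u \<in> S then S - {u} else insert u S)" for S
  have "sum h (Pow {..<j}) = (\<Sum>S\<in>Pow {..<j}. - h S)"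
  proof (rule sum.reindex_bij_witness[of _ flip flip])
    fix S assume S: "S \<in> Pow {..<j}"
    then have fin: "finite S" using finite_subset by auto
    show "flip (flip S) = S" by (auto simp: flip_def)
    show "flip S \<in> Pow {..<j}" using S u by (auto simp: flip_def)
    have "map (vertex (flip S)) I = map (vertex S) I"
    proof (rule map_cong[OF refl])
      fix i assume "i \<in> set I"
      then have "i \<noteq> u" using u by blast
      then show "vertex (flip S) i = vertex S i" by (simp add: flip_def vertex_def)
    qed
    moreover have "(- 1 :: int) ^ card (flip S) = - ((- 1) ^ card S)"
    proof (cases "u \<in> S")
      case True
      then have "card S = Suc (card (flip S))" using card.remove[OF fin] by (simp only: flip_def if_True)
      then show ?thesis by simp
    next
      case False
      then show ?thesis using fin by (simp add: flip_def)
    qed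
    ultimately show "- h (flip S) = h S" unfolding h_def by (simp del: map_eq_conv)
  qed (use u in \<open>auto simp: flip_def\<close>)
  then have "sum h (Pow {..<j}) = 0" by (simp add: sum_negf)
  then show ?case by (simp add: h_def)
next
  case (add P Q)
  then show ?case by (simp add: distrib_left sum.distrib)
qed

locale square_divisor =
  fixes n c x :: int
  assumes n: "n = x * c" and x_dvd_c: "x dvd c" and x2: "2 \<le> x" and c0: "0 < c"
begin

lemma n0: "0 < n"
  using n x2 c0 by simp

lemma c_dvd_n: "c dvd n"
  by (simp add: n)

lemma cong_c_mult: "[u = u'] (mod x) \<Longrightarrow> [c * u = c * u'] (mod n)"
  by (simp add: n mult.commute[of x] cong_iff_dvd_diff flip: right_diff_distrib)

text \<open>
  The representative in \<open>{1..n}\<close>; the residue class of 0 is represented by \<open>n\<close>.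
\<close>
definition rep :: "int \<Rightarrow> nat" where
  "rep v = nat ((v - 1) mod n + 1)"

definition points :: "nat set" where "points = {1..nat n}"

lemma rep_in: "rep v \<in> points"
proof -
  have "0 \<le> (v - 1) mod n" "(v - 1) mod n < n" using n0 by auto
  then show ?thesis by (auto simp: rep_def points_def)
qed

lemma rep_cong: "[int (rep v) = v] (mod n)"
proof -
  have "int (rep v) = (v - 1) mod n + 1" using n0 by (simp add: rep_def)
  moreover have "[(v - 1) mod n + 1 = (v - 1) + 1] (mod n)" by (intro cong_add) (auto simp: cong_def)
  ultimately show ?thesis by simp
qed

lemma points_eqI:
  assumes "a \<in> points" "b \<in> points" "[int a = int b] (mod n)" shows "a = b"
proof -
  have "[int a - 1 = int b - 1] (mod n)" using assms(3) by (intro cong_diff) auto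
  moreover have "int a - 1 \<in> {0..<n}" "int b - 1 \<in> {0..<n}" using assms n0 by (auto simp: points_def)
  ultimately show ?thesis by (simp add: cong_def)
qed

definition vec :: "nat list \<Rightarrow> nat \<Rightarrow> int" where
  "vec xs i = (if i < length xs then int (xs ! i) else 0)"

definition scaled_product_algebra :: "'s \<Rightarrow> 's \<Rightarrow> nat \<Rightarrow> ('s, nat) ualg" where
  "scaled_product_algebra s0 s1 d = \<lparr>carrier = points, symbols = {s0, s1}, arity = (\<lambda>s. if s = s0 then 3 else d),
     interp = (\<lambda>s xs. if s = s0 then rep (vec xs 0 - vec xs 1 + vec xs 2)
       else rep (c * (\<Prod>i\<leftarrow>[0..<d]. vec xs i)))\<rparr>"

lemma scaled_product_algebra_simps [simp]: "carrier (scaled_product_algebra s0 s1 d) = points" "symbols (scaled_product_algebra s0 s1 d) = {s0, s1}"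
  by (simp_all add: scaled_product_algebra_def)

lemma is_ualg_scaled_product_algebra: "1 \<le> d \<Longrightarrow> is_ualg (scaled_product_algebra s0 s1 d)"
  using rep_in n0 by (auto simp: is_ualg_def scaled_product_algebra_def points_def)

lemma malcev_scaled_product_algebra: "malcev (scaled_product_algebra s0 s1 d)"
proof -
  let ?m = "restrict (interp (scaled_product_algebra s0 s1 d) s0) (tuples points 3)"
  have "(3, ?m) \<in> clone (scaled_product_algebra s0 s1 d)"
    using clone.basic[of s0 "scaled_product_algebra s0 s1 d"] by (simp add: scaled_product_algebra_def)
  moreover have "?m [a, b, b] = a \<and> ?m [b, b, a] = a" if "a \<in> points" "b \<in> points" for a b
  proof -
    have "rep (int a) = a" using that rep_in rep_cong by (intro points_eqI) auto
    then show ?thesis using that by (simp add: tuples_def scaled_product_algebra_def vec_def)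
  qed
  ultimately show ?thesis unfolding malcev_def by auto
qed

text \<open>
  When such operations are composed, the summands \<open>c Q\<close> of the inner ones may be dropped inside the outer polynomial:
  they vanish modulo \<open>x\<close>, and the outer polynomial is multiplied by \<open>c\<close>.
\<close>
lemma clone_scaled_product_algebra_form:
  assumes d: "1 \<le> d" and "(k, t) \<in> clone (scaled_product_algebra s0 s1 d)"
  shows "\<exists>a P. poly_fun d P \<and> (\<forall>xs\<in>tuples points k. [int (t xs) = (\<Sum>i<k. a i * vec xs i) + c * P (vec xs)] (mod n))"
  using assms(2)
proof induction
  case (proj i k)
  have "(\<Sum>j<k. (if j = i then 1 else 0) * vec xs j) = int (xs ! i)" if "xs \<in> tuples points k" for xs
    using that proj by (auto simp: vec_def tuples_def if_distrib[of "\<lambda>z. z * _"] cong: if_cong)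
  then show ?case
    by (intro exI[of _ "\<lambda>j. if j = i then 1 else 0"] exI[of _ "\<lambda>v. 0"]) (auto intro: poly_fun_zero)
next
  case (basic s)
  show ?case
  proof (cases "s = s0")
    case True
    have "[int (interp (scaled_product_algebra s0 s1 d) s xs) = (\<Sum>i<3. [1, -1, 1] ! i * vec xs i) + c * 0] (mod n)" for xs
    proof -
      have "(\<Sum>i<3. [1, -1, 1] ! i * vec xs i) + c * 0 = vec xs 0 - vec xs 1 + vec xs 2"
        by (simp add: numeral_3_eq_3 numeral_2_eq_2 lessThan_Suc)
      then show ?thesis using rep_cong by (simp add: True scaled_product_algebra_def)
    qed
    then show ?thesis
      by (intro exI[of _ "\<lambda>i. [1, -1, 1] ! i"] exI[of _ "\<lambda>v. 0"])
        (auto intro: poly_fun_zero simp: True scaled_product_algebra_def)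
  next
    case False
    have "poly_fun d (\<lambda>v. 1 * (\<Prod>i\<leftarrow>[0..<d]. v i))" by (rule poly_fun.monomial) simp
    moreover have "[int (interp (scaled_product_algebra s0 s1 d) s xs) = (\<Sum>i<d. 0 * vec xs i) + c * (1 * (\<Prod>i\<leftarrow>[0..<d]. vec xs i))] (mod n)" for xs
      using rep_cong by (simp add: False scaled_product_algebra_def)
    ultimately show ?thesis
      using False by (intro exI[of _ "\<lambda>_. 0"] exI[of _ "\<lambda>v. 1 * (\<Prod>i\<leftarrow>[0..<d]. v i)"]) (auto simp: scaled_product_algebra_def)
  qed
next
  case (comp gs f k)
  let ?m = "length gs"
  obtain b P where P: "poly_fun d P"
    and f: "\<And>ys. ys \<in> tuples points ?m \<Longrightarrow> [int (f ys) = (\<Sum>i<?m. b i * vec ys i) + c * P (vec ys)] (mod n)"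
    using comp.IH(1) by blast
  have "\<forall>i. \<exists>a Q. i < ?m \<longrightarrow> poly_fun d Q \<and>
      (\<forall>xs\<in>tuples points k. [int ((gs ! i) xs) = (\<Sum>j<k. a j * vec xs j) + c * Q (vec xs)] (mod n))"
    using comp.IH(2) nth_mem by blast
  then obtain a Q where Q: "\<And>i. i < ?m \<Longrightarrow> poly_fun d (Q i)"
    and g: "\<And>i xs. i < ?m \<Longrightarrow> xs \<in> tuples points k \<Longrightarrow>
      [int ((gs ! i) xs) = (\<Sum>j<k. a i j * vec xs j) + c * Q i (vec xs)] (mod n)" by metis
  define a' where "a' i j = (if i < ?m then a i j else 0)" for i j
  define R where "R v = (\<Sum>i<?m. b i * Q i v) + P (\<lambda>i. \<Sum>j<k. a' i j * v j)" for v
  have R: "poly_fun d R"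
    unfolding R_def using P Q by (intro poly_fun.add poly_fun_sum poly_fun_scale poly_fun_linear_subst) auto
  have "[int (f (map (\<lambda>g. g xs) gs)) = (\<Sum>j<k. (\<Sum>i<?m. b i * a i j) * vec xs j) + c * R (vec xs)] (mod n)"
    if xs: "xs \<in> tuples points k" for xs
  proof -
    let ?ys = "map (\<lambda>g. g xs) gs" and ?v = "vec xs"
    have ys: "?ys \<in> tuples points ?m"
      using clone_closed[OF is_ualg_scaled_product_algebra[OF d] comp.hyps(3)] xs by (auto simp: tuples_def)
    have vec_ys: "vec ?ys i = int ((gs ! i) xs)" if "i < ?m" for i using that by (simp add: vec_def)
    have lin: "[vec ?ys i = (\<Sum>j<k. a' i j * ?v j)] (mod x)" for i
    proof (cases "i < ?m")
      case True
      have "[int ((gs ! i) xs) = (\<Sum>j<k. a i j * ?v j) + c * Q i ?v] (mod x)"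
        using g[OF True xs] by (rule cong_dvd_modulus) (simp add: n)
      moreover have "[(\<Sum>j<k. a i j * ?v j) + c * Q i ?v = (\<Sum>j<k. a i j * ?v j) + 0] (mod x)"
        using x_dvd_c by (intro cong_add cong_refl) (simp add: cong_0_iff)
      ultimately have "[int ((gs ! i) xs) = (\<Sum>j<k. a i j * ?v j) + 0] (mod x)" by (rule cong_trans)
      then show ?thesis using True by (simp add: vec_ys a'_def)
    next
      case False
      then show ?thesis by (simp add: vec_def a'_def)
    qed
    have 1: "[(\<Sum>i<?m. b i * vec ?ys i) + c * P (vec ?ys)
        = (\<Sum>i<?m. b i * ((\<Sum>j<k. a i j * ?v j) + c * Q i ?v)) + c * P (\<lambda>i. \<Sum>j<k. a' i j * ?v j)] (mod n)"
      using g[OF _ xs] by (intro cong_add cong_sum cong_mult[OF cong_refl] cong_c_mult poly_fun_cong[OF P] lin) (simp add: vec_ys)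
    have 2: "(\<Sum>i<?m. b i * ((\<Sum>j<k. a i j * ?v j) + c * Q i ?v)) + c * P (\<lambda>i. \<Sum>j<k. a' i j * ?v j)
        = (\<Sum>j<k. (\<Sum>i<?m. b i * a i j) * ?v j) + c * R ?v"
    proof -
      have "(\<Sum>j<k. (\<Sum>i<?m. b i * a i j) * ?v j) = (\<Sum>i<?m. b i * (\<Sum>j<k. a i j * ?v j))"
        by (simp add: sum_distrib_left sum_distrib_right mult.assoc) (rule sum.swap)
      then show ?thesis
        by (simp add: R_def distrib_left sum.distrib sum_distrib_left mult.left_commute)
    qed
    show ?thesis using cong_trans[OF f[OF ys] 1] unfolding 2 .
  qed
  with R show ?case by (intro exI[of _ "\<lambda>j. \<Sum>i<?m. b i * a i j"] exI[of _ R]) auto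
qed

definition mod_cong :: "int \<Rightarrow> (nat \<times> nat) set" where
  "mod_cong \<mu> = {(a, b). a \<in> points \<and> b \<in> points \<and> [int a = int b] (mod \<mu>)}"

lemma mod_cong_n: "mod_cong n = Id_on points"
  using points_eqI by (auto simp: mod_cong_def)

lemma congruence_mod_cong:
  assumes "\<mu> dvd n" shows "congruence (scaled_product_algebra s0 s1 d) (mod_cong \<mu>)"
  unfolding congruence_def
proof (intro conjI ballI allI impI)
  show "equiv (carrier (scaled_product_algebra s0 s1 d)) (mod_cong \<mu>)"
    by (auto simp: equiv_def refl_on_def sym_def trans_def mod_cong_def intro: cong_sym cong_trans)
  fix s xs ys
  assume *: "length xs = arity (scaled_product_algebra s0 s1 d) s \<and> list_all2 (\<lambda>x y. (x, y) \<in> mod_cong \<mu>) xs ys"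
  have v: "[vec xs i = vec ys i] (mod \<mu>)" for i
    using * by (auto simp: vec_def list_all2_conv_all_nth mod_cong_def)
  have "[(\<Prod>i\<leftarrow>I. vec xs i) = (\<Prod>i\<leftarrow>I. vec ys i)] (mod \<mu>)" for I
    by (induction I) (auto intro: cong_mult v)
  moreover have r: "[int (rep u) = int (rep u')] (mod \<mu>)" if "[u = u'] (mod \<mu>)" for u u'
    using that rep_cong[of u, THEN cong_dvd_modulus, OF assms] rep_cong[of u', THEN cong_dvd_modulus, OF assms]
    by (metis cong_sym cong_trans)
  ultimately show "(interp (scaled_product_algebra s0 s1 d) s xs, interp (scaled_product_algebra s0 s1 d) s ys) \<in> mod_cong \<mu>"
    by (auto simp: scaled_product_algebra_def mod_cong_def rep_in intro!: r cong_add cong_diff cong_mult v)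
qed

text \<open>
  If moving along \<open>\<beta>\<close> does not affect the polynomial part modulo \<open>\<mu>\<close>, then it changes the value of a term operation
  by a linear form in the displacement, which does not see the remaining arguments.
\<close>
lemma centralizes_mod_cong:
  assumes d: "1 \<le> d" and \<mu>: "\<mu> dvd n" and \<beta>: "\<beta> \<subseteq> points \<times> points"
    and poly: "\<And>P v v'. poly_fun d P \<Longrightarrow> (\<And>i. v i = v' i \<or> (\<exists>(a, b)\<in>\<beta>. v i = int a \<and> v' i = int b)) \<Longrightarrow>
      [c * P v = c * P v'] (mod \<mu>)"
  shows "centralizes (scaled_product_algebra s0 s1 d) (one_cong (scaled_product_algebra s0 s1 d)) \<beta> (mod_cong \<mu>)"
  unfolding centralizes_def
proof (intro allI impI)
  fix t as bs cs ds
  assume t: "(length as + length cs, t) \<in> clone (scaled_product_algebra s0 s1 d)"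
    and ab: "list_all2 (\<lambda>a b. (a, b) \<in> one_cong (scaled_product_algebra s0 s1 d)) as bs"
    and cd: "list_all2 (\<lambda>c d. (c, d) \<in> \<beta>) cs ds"
    and eq: "(t (as @ cs), t (as @ ds)) \<in> mod_cong \<mu>"
  let ?k = "length as + length cs"
  obtain a P where P: "poly_fun d P"
    and form: "\<And>xs. xs \<in> tuples points ?k \<Longrightarrow> [int (t xs) = (\<Sum>i<?k. a i * vec xs i) + c * P (vec xs)] (mod \<mu>)"
    using clone_scaled_product_algebra_form[OF d t] cong_dvd_modulus[OF _ \<mu>] by blast
  have "as \<in> tuples points (length as)" "bs \<in> tuples points (length as)"
    using list_all2_in_tuples[OF _ refl ab, of points] by (auto simp: one_cong_def)
  moreover have "cs \<in> tuples points (length cs)" "ds \<in> tuples points (length cs)"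
    using list_all2_in_tuples[OF \<beta> refl cd] by auto
  ultimately have X: "as @ cs \<in> tuples points ?k" "as @ ds \<in> tuples points ?k" "bs @ cs \<in> tuples points ?k" "bs @ ds \<in> tuples points ?k"
    and len: "length bs = length as" "length ds = length cs"
    by (auto simp: tuples_def)
  have Pcong: "[c * P (vec (us @ cs)) = c * P (vec (us @ ds))] (mod \<mu>)" for us
  proof (rule poly[OF P])
    fix i
    show "vec (us @ cs) i = vec (us @ ds) i \<or> (\<exists>(a, b)\<in>\<beta>. vec (us @ cs) i = int a \<and> vec (us @ ds) i = int b)"
    proof (cases "length us \<le> i \<and> i < length us + length cs")
      case True
      then have "(cs ! (i - length us), ds ! (i - length us)) \<in> \<beta>"
        using cd by (auto simp: list_all2_conv_all_nth)
      then show ?thesis using True len by (force simp: vec_def nth_append)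
    next
      case False
      then show ?thesis using len by (auto simp: vec_def nth_append)
    qed
  qed
  define D where "D = (\<Sum>i<?k. a i * (vec (as @ cs) i - vec (as @ ds) i))"
  have D': "D = (\<Sum>i<?k. a i * (vec (bs @ cs) i - vec (bs @ ds) i))"
    unfolding D_def by (rule sum.cong) (auto simp: vec_def nth_append len)
  have diff: "[int (t (us @ cs)) - int (t (us @ ds)) = (\<Sum>i<?k. a i * (vec (us @ cs) i - vec (us @ ds) i))] (mod \<mu>)"
    if "us @ cs \<in> tuples points ?k" "us @ ds \<in> tuples points ?k" for us
  proof -
    let ?s = "\<lambda>zs. \<Sum>i<?k. a i * vec zs i"
    have 1: "[int (t (us @ cs)) - int (t (us @ ds)) =
        (?s (us @ cs) + c * P (vec (us @ cs))) - (?s (us @ ds) + c * P (vec (us @ ds)))] (mod \<mu>)"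
      by (intro cong_diff form that)
    have 2: "[(?s (us @ cs) + c * P (vec (us @ cs))) - (?s (us @ ds) + c * P (vec (us @ ds))) =
        (?s (us @ cs) + c * P (vec (us @ ds))) - (?s (us @ ds) + c * P (vec (us @ ds)))] (mod \<mu>)"
      by (intro cong_diff cong_add cong_refl Pcong)
    have 3: "(?s (us @ cs) + c * P (vec (us @ ds))) - (?s (us @ ds) + c * P (vec (us @ ds))) =
        (\<Sum>i<?k. a i * (vec (us @ cs) i - vec (us @ ds) i))"
      by (simp add: right_diff_distrib sum_subtractf)
    show ?thesis using cong_trans[OF 1 2] unfolding 3 .
  qed
  have "[D = 0] (mod \<mu>)"
  proof -
    have "[int (t (as @ cs)) - int (t (as @ ds)) = 0] (mod \<mu>)"
      using eq by (simp add: mod_cong_def cong_iff_dvd_diff)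
    from cong_trans[OF cong_sym[OF diff[OF X(1,2)]] this] show ?thesis unfolding D_def .
  qed
  then have "[int (t (bs @ cs)) - int (t (bs @ ds)) = 0] (mod \<mu>)"
    unfolding D' by (rule cong_trans[OF diff[OF X(3,4)]])
  then show "(t (bs @ cs), t (bs @ ds)) \<in> mod_cong \<mu>"
    using clone_closed[OF is_ualg_scaled_product_algebra[OF d] t] X by (simp add: mod_cong_def cong_iff_dvd_diff)
qed

text \<open>
  Modulo \<open>c\<close> the polynomial part vanishes, so \<open>[1, 1]\<close> is contained in congruence modulo \<open>c\<close>. Congruence modulo \<open>c\<close>
  implies congruence modulo \<open>x\<close>, which does not affect \<open>c\<close> times a polynomial.
\<close>
lemma two_nilpotent_scaled_product_algebra:
  assumes d: "1 \<le> d" shows "two_nilpotent (scaled_product_algebra s0 s1 d)"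
proof -
  let ?W = "scaled_product_algebra s0 s1 d"
  let ?\<gamma> = "commutator ?W (one_cong ?W) (one_cong ?W)"
  have "centralizes ?W (one_cong ?W) (one_cong ?W) (mod_cong c)"
  proof (rule centralizes_mod_cong[OF d c_dvd_n])
    show "one_cong ?W \<subseteq> points \<times> points" by (simp add: one_cong_def)
    show "[c * P v = c * P v'] (mod c)" for P and v v' :: "nat \<Rightarrow> int"
      by (simp add: cong_iff_dvd_diff)
  qed
  then have \<gamma>: "?\<gamma> \<subseteq> mod_cong c"
    by (rule commutator_least[OF congruence_mod_cong[OF c_dvd_n]])
  have "centralizes ?W (one_cong ?W) ?\<gamma> (mod_cong n)"
  proof (rule centralizes_mod_cong[OF d dvd_refl])
    show "?\<gamma> \<subseteq> points \<times> points" using \<gamma> by (auto simp: mod_cong_def)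
    fix P and v v' :: "nat \<Rightarrow> int"
    assume P: "poly_fun d P" and v: "\<And>i. v i = v' i \<or> (\<exists>(a, b)\<in>?\<gamma>. v i = int a \<and> v' i = int b)"
    have "[v i = v' i] (mod x)" for i
    proof (cases "v i = v' i")
      case False
      then obtain a b where "(a, b) \<in> ?\<gamma>" "v i = int a" "v' i = int b" using v[of i] by blast
      then have "[v i = v' i] (mod c)" using \<gamma> by (auto simp: mod_cong_def)
      then show ?thesis using x_dvd_c by (rule cong_dvd_modulus)
    qed simp
    then show "[c * P v = c * P v'] (mod n)" by (intro cong_c_mult poly_fun_cong[OF P])
  qed
  then have "commutator ?W (one_cong ?W) ?\<gamma> \<subseteq> mod_cong n"
    by (rule commutator_least[OF congruence_mod_cong[OF dvd_refl]])
  moreover have "Id_on points \<subseteq> commutator ?W (one_cong ?W) \<beta>" for \<beta>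
    unfolding commutator_def by (auto simp: congruence_def equiv_def refl_on_def)
  ultimately show ?thesis
    unfolding two_nilpotent_def zero_cong_def mod_cong_n scaled_product_algebra_simps by (intro equalityI)
qed

text \<open>
  Over the cube \<open>{0,1}^j\<close>, the alternating sum of \<open>c w\<^sub>1 \<cdots> w\<^sub>j\<close> is \<open>c\<close> up to sign, which is nonzero modulo \<open>n\<close>, whereas it
  annihilates linear forms (as \<open>j > d \<ge> 1\<close>) and polynomials of degree at most \<open>d\<close>.
\<close>
lemma clone_scaled_product_algebra_distinct:
  assumes d: "1 \<le> d" "d < j" and s: "s0 \<noteq> s1"
  shows "clone (scaled_product_algebra s0 s1 d) \<noteq> clone (scaled_product_algebra s0 s1 j)"
proof
  assume eq: "clone (scaled_product_algebra s0 s1 d) = clone (scaled_product_algebra s0 s1 j)"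
  let ?f = "restrict (interp (scaled_product_algebra s0 s1 j) s1) (tuples points j)"
  have "(j, ?f) \<in> clone (scaled_product_algebra s0 s1 j)"
    using clone.basic[of s1 "scaled_product_algebra s0 s1 j"] s by (simp add: scaled_product_algebra_def)
  then have "(j, ?f) \<in> clone (scaled_product_algebra s0 s1 d)" by (simp only: eq)
  from clone_scaled_product_algebra_form[OF d(1) this] obtain a P where P: "poly_fun d P"
    and form: "\<And>xs. xs \<in> tuples points j \<Longrightarrow> [int (?f xs) = (\<Sum>i<j. a i * vec xs i) + c * P (vec xs)] (mod n)"
    by blast
  define L where "L v = (\<Sum>i<j. a i * v i)" for v :: "nat \<Rightarrow> int"
  have L: "poly_fun d L"
  proof -
    have "poly_fun 1 L"
      using poly_fun_times_linear[where d = 0 and P = "\<lambda>v. 1" and k = j and b = a]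
        poly_fun.monomial[of "[]" 0 1] by (simp add: L_def[abs_def])
    then show ?thesis using d(1) poly_fun_mono by blast
  qed
  have vertex_eq: "[c * (\<Prod>i\<leftarrow>[0..<j]. vertex S i) = L (vertex S) + c * P (vertex S)] (mod n)" if S: "S \<subseteq> {..<j}" for S
  proof -
    define xs where "xs = map (\<lambda>i. rep (vertex S i)) [0..<j]"
    have xs: "xs \<in> tuples points j" by (auto simp: xs_def rep_in tuples_def)
    have v: "[vec xs i = vertex S i] (mod n)" for i
      using rep_cong S by (auto simp: vec_def xs_def vertex_def)
    have vx: "[vec xs i = vertex S i] (mod x)" for i
      using v by (rule cong_dvd_modulus) (simp add: n)
    have 1: "[c * (\<Prod>i\<leftarrow>[0..<j]. vertex S i) = c * (1 * (\<Prod>i\<leftarrow>[0..<j]. vec xs i))] (mod n)"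
      using poly_fun_cong[OF poly_fun.monomial[of "[0..<j]" j 1] vx] by (intro cong_c_mult) (simp add: cong_sym)
    have 2: "[c * (1 * (\<Prod>i\<leftarrow>[0..<j]. vec xs i)) = int (?f xs)] (mod n)"
      using xs rep_cong s by (simp add: scaled_product_algebra_def cong_sym)
    have 3: "[(\<Sum>i<j. a i * vec xs i) + c * P (vec xs) = L (vertex S) + c * P (vertex S)] (mod n)"
      unfolding L_def
      by (rule cong_add[OF cong_sum[OF cong_mult[OF cong_refl v]] cong_c_mult[OF poly_fun_cong[OF P vx]]])
    show ?thesis using cong_trans[OF 1 cong_trans[OF 2 cong_trans[OF form[OF xs] 3]]] .
  qed
  have 1: "[(\<Sum>S\<in>Pow {..<j}. (- 1) ^ card S * (c * (\<Prod>i\<leftarrow>[0..<j]. vertex S i))) =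
      (\<Sum>S\<in>Pow {..<j}. (- 1) ^ card S * (L (vertex S) + c * P (vertex S)))] (mod n)"
    by (rule cong_sum, rule cong_mult[OF cong_refl vertex_eq]) simp
  have 2: "(\<Sum>S\<in>Pow {..<j}. (- 1) ^ card S * (L (vertex S) + c * P (vertex S))) = 0"
    using poly_fun_alternating_sum[OF poly_fun.add[OF L poly_fun_scale[OF P, of c]] d(2)] by simp
  have 3: "(\<Sum>S\<in>Pow {..<j}. (- 1) ^ card S * (c * (\<Prod>i\<leftarrow>[0..<j]. vertex S i))) = (- 1) ^ j * c"
  proof -
    have prod_vertex: "(\<Prod>i\<leftarrow>[0..<j]. vertex S i) = (if S = {..<j} then 1 else 0)" if "S \<subseteq> {..<j}" for S
    proof (cases "S = {..<j}")
      case True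
      have "(\<Prod>i\<leftarrow>[0..<j]. vertex S i) = (\<Prod>i\<leftarrow>[0..<j]. 1)"
        by (intro arg_cong[where f = prod_list] map_cong) (auto simp: True vertex_def)
      also have "\<dots> = 1" by (induction j) auto
      finally show ?thesis using True by simp
    next
      case False
      then obtain u where "u < j" "u \<notin> S" using \<open>S \<subseteq> {..<j}\<close> by blast
      then have "vertex S u \<in> vertex S ` set [0..<j]" "vertex S u = 0" by (simp_all add: vertex_def)
      then show ?thesis using False by (simp add: prod_list_zero_iff)
    qed
    have "(\<Sum>S\<in>Pow {..<j}. (- 1) ^ card S * (c * (\<Prod>i\<leftarrow>[0..<j]. vertex S i)))
        = (\<Sum>S\<in>Pow {..<j}. if S = {..<j} then (- 1) ^ j * c else 0)"
    proof (rule sum.cong)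
      show "(- 1) ^ card S * (c * (\<Prod>i\<leftarrow>[0..<j]. vertex S i)) = (if S = {..<j} then (- 1) ^ j * c else 0)"
        if "S \<in> Pow {..<j}" for S
        using prod_vertex[of S] that by simp
    qed simp
    then show ?thesis by simp
  qed
  have "n dvd (- 1) ^ j * c" using 1 unfolding 2 3 by (simp only: cong_0_iff)
  then have "n dvd c" by (cases "even j") (simp_all only: minus_one_power_iff if_True if_False mult_1 mult_minus1 dvd_minus_iff)
  then have "n \<le> c" using c0 by (rule zdvd_imp_le)
  moreover have "2 * c \<le> x * c" using x2 c0 by (intro mult_right_mono) auto
  ultimately show False using n c0 by linarith
qed

end

text \<open>
  For \<open>n = x\<^sup>2 r\<close> the constant is \<open>c = x r\<close>.
\<close>
theorem infinite_term_equivalence_classes: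
  fixes n :: nat
  assumes n: "1 \<le> n" and sq: "\<not> squarefree n"
  shows "infinite (term_equivalence_classes (two_nilpotent_malcev_algebras {1..n} :: ('s::infinite, nat) ualg set))"
proof
  let ?K = "two_nilpotent_malcev_algebras {1..n} :: ('s, nat) ualg set"
  assume fin: "finite (term_equivalence_classes ?K)"
  obtain x where x: "x ^ 2 dvd n" "\<not> x dvd 1" using sq by (rule not_squarefreeE)
  then obtain r where r: "n = x ^ 2 * r" by auto
  have x0: "x \<noteq> 0" and "r \<noteq> 0" using r n by (auto intro: ccontr)
  interpret square_divisor "int n" "int (x * r)" "int x"
  proof
    show "2 \<le> int x" using x x0 by (cases x) (auto simp: Suc_le_eq)
    show "0 < int (x * r)" using x0 \<open>r \<noteq> 0\<close> by simp
  qed (auto simp: r power2_eq_square)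
  obtain s0 s1 :: 's where s: "s0 \<noteq> s1"
    using arb_element[of "{undefined :: 's}"] by auto
  define V where "V d = (scaled_product_algebra s0 s1 (Suc d) :: ('s, nat) ualg)" for d
  have V: "V d \<in> ?K" for d
  proof -
    have "carrier (V d) = {1..n}" by (simp only: V_def scaled_product_algebra_simps points_def nat_int)
    moreover have "is_ualg (V d)" unfolding V_def by (rule is_ualg_scaled_product_algebra) simp
    moreover have "malcev (V d)" unfolding V_def by (rule malcev_scaled_product_algebra)
    moreover have "two_nilpotent (V d)" unfolding V_def by (rule two_nilpotent_scaled_product_algebra) simp
    ultimately show ?thesis by (simp add: two_nilpotent_malcev_algebras_def)
  qed
  let ?R = "{(A, B). A \<in> ?K \<and> B \<in> ?K \<and> term_equivalent A B}"
  have inj: "inj (\<lambda>d. ?R `` {V d})"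
  proof (rule linorder_injI)
    fix d e :: nat assume "d < e"
    then have "clone (V d) \<noteq> clone (V e)" unfolding V_def by (intro clone_scaled_product_algebra_distinct s) auto
    moreover have "V e \<in> ?R `` {V e}" using V by (auto simp: term_equivalent_def)
    ultimately show "?R `` {V d} \<noteq> ?R `` {V e}" by (auto simp: term_equivalent_def)
  qed
  have "range (\<lambda>d. ?R `` {V d}) \<subseteq> term_equivalence_classes ?K"
  proof (rule image_subsetI)
    show "?R `` {V d} \<in> term_equivalence_classes ?K" for d
      unfolding term_equivalence_classes_def by (rule quotientI[OF V])
  qed
  from finite_imageD[OF finite_subset[OF this fin] inj] show False by simp
qed

section \<open>The characterization\<close>

theorem theorem1p6:
  fixes n :: nat
  assumes "1 \<le> n"
  shows "finite (term_equivalence_classes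
           (two_nilpotent_malcev_algebras {1..n} :: ('s::infinite, nat) ualg set))
         \<longleftrightarrow> squarefree n"
  using assms finite_term_equivalence_classes[of "{1..n}"] infinite_term_equivalence_classes[of n]
  by auto

end
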